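(* Let $(X,d)$ be a Polish metric space, $1<p<\infty$, $E:\mathcal P_p(X)\to(-\infty,+\infty]$ proper and $G:\mathcal P_p(X)\to[0,+\infty]$ a weak upper gradient for $E$. Assume $E$ and $G$ have extensions $\tilde E:\mathcal P(X)\to(-\infty,+\infty]$, $\tilde G:\mathcal P(X)\to[0,+\infty]$ (agreeing with $E,G$ on $\mathcal P_p(X)$) satisfying (B1), (B3) and either (B2) or (B2'). Assume that for every $\rho_0\in Z_{E,p}$ there exists a $p$-curve of maximal slope $\rho\in AC([0,\infty);\mathcal P_p(X))$ of $E$ with respect to $G$ with $\rho(0)=\rho_0$. Then for any such curve, $$\lim_{t\to\infty}d_{LP}(\rho(t),\mathcal E_w)=\lim_{t\to\infty}\inf_{\mu\in\mathcal E_w}d_{LP}(\rho(t),\mu)=0.$$ Furthermore, if (B2') is satisfied with a set $\mathcal Y$ closed in $\mathcal P(X)$, then $\lim_{t\to\infty}d_{LP}(\rho(t),\mathcal E_w\cap\mathcal Y)=0$.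
   Context: $\mathcal P(X)$: Borel probability measures on $X$ with the narrow topology, metrised by the Lévy–Prokhorov metric $d_{LP}$. $\mathcal P_p(X)$: measures with finite $p$-th moment, with the $p$-Wasserstein distance $W_p$. $q=p/(p-1)$. $\rho\in AC([0,\infty);\mathcal P_p(X))$ means: for each $T>0$ there is $m\in L^1([0,T])$ with $W_p(\rho(t),\rho(s))\le\int_s^tm$ for $0\le s<t\le T$; metric derivative $|\rho'|(t)=\lim_{s\to t}W_p(\rho(t),\rho(s))/|t-s|$ (exists a.e.). $G$ is a weak upper gradient for $E$ if for every absolutely continuous curve $\rho$ on $[0,T]$ with $(G\circ\rho)|\rho'|\in L^1([0,T])$, $E\circ\rho$ is a.e. equal to a function $\varphi$ of finite pointwise variation with $|\varphi'|\le G(\rho)|\rho'|$ a.e. A $p$-curve of maximal slope for $E$ w.r.t. $G$ is $\rho\in AC([0,\infty);\mathcal P_p(X))$ with $E\circ\rho$ a.e. equal to a non-increasing $\varphi$ satisfying $\varphi'(t)=-\frac1p|\rho'|^p(t)-\frac1qG^q(\rho(t))$ for a.e. $t$. $Z_{E,p}=\{\rho\in\mathcal P_p(X):E(\rho)<\infty\}$. A weak stationary state is $\mu\in\mathcal P(X)$ with $\tilde E(\mu)<\infty$ and $\tilde G(\mu)=0$; $\mathcal E_w$ is their set. $d_{LP}(\mu,A)=\inf_{\nu\in A}d_{LP}(\mu,\nu)$. (B1) $\tilde E$ proper, bounded below, l.s.c. on $\mathcal P(X)$. (B2) For every $C\in\mathbb R$, $\{\mu\in\mathcal P(X):\tilde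 E(\mu)\le C\}$ is relatively compact in $\mathcal P(X)$. (B2') There is $\mathcal Y\subset\mathcal P(X)$ containing $\rho(t)$ for all $t\ge0$ such that $\{\mu\in\mathcal P_p(X)\cap\mathcal Y:E(\mu)\le C\}$ is relatively compact in $\mathcal P(X)$ for every $C$. (B3) $\tilde G$ l.s.c. on $\mathcal P(X)$. *)

theory Defs
  imports "HOL-Probability.Probability"
begin

definition Prob :: "('a::polish_space) measure set" where
  "Prob = {M. prob_space M \<and> sets M = sets borel}"

definition Prob_p :: "real \<Rightarrow> ('a::polish_space) measure set" where
  "Prob_p p = {M \<in> Prob. \<exists>x0. (\<integral>\<^sup>+ x. ennreal (dist x x0 powr p) \<partial>M) < \<infinity>}"

definition nbhd :: "('a::metric_space) set \<Rightarrow> real \<Rightarrow> 'a set" where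
  "nbhd A e = {x. \<exists>y\<in>A. dist x y < e}"

definition dLP :: "('a::polish_space) measure \<Rightarrow> 'a measure \<Rightarrow> real" where
  "dLP \<mu> \<nu> = Inf {e. e > 0 \<and> (\<forall>A \<in> sets borel.
       measure \<mu> A \<le> measure \<nu> (nbhd A e) + e \<and> measure \<nu> A \<le> measure \<mu> (nbhd A e) + e)}"

definition dLP_set :: "('a::polish_space) measure \<Rightarrow> 'a measure set \<Rightarrow> real" where
  "dLP_set \<mu> S = (INF \<nu>\<in>S. dLP \<mu> \<nu>)"

text \<open>Narrow convergence (the narrow topology is metrised by dLP).\<close>
definition narrow_conv :: "(nat \<Rightarrow> ('a::polish_space) measure) \<Rightarrow> 'a measure \<Rightarrow> bool" where
  "narrow_conv M \<mu> \<longleftrightarrow> \<mu> \<in> Prob \<and> (\<forall>n. M n \<in> Prob) \<and> (\<lambda>n. dLP (M n) \<mu>) \<longlonglongrightarrow> 0"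

definition lsc_narrow :: "(('a::polish_space) measure \<Rightarrow> 'b::{linorder_topology,complete_linorder}) \<Rightarrow> bool" where
  "lsc_narrow F \<longleftrightarrow> (\<forall>M \<mu>. narrow_conv M \<mu> \<longrightarrow> F \<mu> \<le> liminf (\<lambda>n. F (M n)))"

definition rel_compact_narrow :: "('a::polish_space) measure set \<Rightarrow> bool" where
  "rel_compact_narrow S \<longleftrightarrow> S \<subseteq> Prob \<and>
     (\<forall>M. (\<forall>n. M n \<in> S) \<longrightarrow> (\<exists>(r::nat\<Rightarrow>nat) \<mu>. strict_mono r \<and> narrow_conv (M \<circ> r) \<mu>))"

definition closed_narrow :: "('a::polish_space) measure set \<Rightarrow> bool" where
  "closed_narrow S \<longleftrightarrow> S \<subseteq> Prob \<and> (\<forall>M \<mu>. (\<forall>n. M n \<in> S) \<longrightarrow> narrow_conv M \<mu> \<longrightarrow> \<mu> \<in> S)"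

definition couplings :: "('a::polish_space) measure \<Rightarrow> 'a measure \<Rightarrow> ('a \<times> 'a) measure set" where
  "couplings \<mu> \<nu> = {\<pi>. prob_space \<pi> \<and> sets \<pi> = sets (borel :: ('a \<times> 'a) measure) \<and>
       distr \<pi> borel fst = \<mu> \<and> distr \<pi> borel snd = \<nu>}"

definition Wass :: "real \<Rightarrow> ('a::polish_space) measure \<Rightarrow> 'a measure \<Rightarrow> real" where
  "Wass p \<mu> \<nu> = enn2real (INF \<pi>\<in>couplings \<mu> \<nu>. \<integral>\<^sup>+ z. ennreal (dist (fst z) (snd z) powr p) \<partial>\<pi>) powr (1/p)"

definition AC_on :: "real \<Rightarrow> real \<Rightarrow> (real \<Rightarrow> ('a::polish_space) measure) \<Rightarrow> bool" where
  "AC_on p T \<rho> \<longleftrightarrow> (\<forall>t\<in>{0..T}. \<rho> t \<in> Prob_p p) \<and>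
     (\<exists>m. set_integrable lebesgue {0..T} m \<and>
        (\<forall>s t. 0 \<le> s \<and> s < t \<and> t \<le> T \<longrightarrow> Wass p (\<rho> t) (\<rho> s) \<le> (LINT u:{s..t}|lebesgue. m u)))"

definition AC_infty :: "real \<Rightarrow> (real \<Rightarrow> ('a::polish_space) measure) \<Rightarrow> bool" where
  "AC_infty p \<rho> \<longleftrightarrow> (\<forall>t\<ge>0. \<rho> t \<in> Prob_p p) \<and> (\<forall>T>0. AC_on p T \<rho>)"

definition mderiv :: "real \<Rightarrow> real set \<Rightarrow> (real \<Rightarrow> ('a::polish_space) measure) \<Rightarrow> real \<Rightarrow> real" where
  "mderiv p I \<rho> t = Lim (at t within I) (\<lambda>s. Wass p (\<rho> t) (\<rho> s) / \<bar>t - s\<bar>)"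

definition finite_variation_on :: "(real \<Rightarrow> real) \<Rightarrow> real \<Rightarrow> real \<Rightarrow> bool" where
  "finite_variation_on f a b \<longleftrightarrow> (\<exists>B. \<forall>n (s::nat \<Rightarrow> real).
      a \<le> s 0 \<and> s n \<le> b \<and> (\<forall>i<n. s i \<le> s (Suc i)) \<longrightarrow>
      (\<Sum>i<n. \<bar>f (s (Suc i)) - f (s i)\<bar>) \<le> B)"

definition weak_upper_gradient ::
  "real \<Rightarrow> (('a::polish_space) measure \<Rightarrow> ereal) \<Rightarrow> ('a measure \<Rightarrow> ennreal) \<Rightarrow> bool" where
  "weak_upper_gradient p E G \<longleftrightarrow>
     (\<forall>T \<rho>. T > 0 \<and> AC_on p T \<rho> \<and>
        (\<lambda>t. G (\<rho> t) * ennreal (mderiv p {0..T} \<rho> t)) \<in> borel_measurable lebesgue \<and>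
        (\<integral>\<^sup>+ t\<in>{0..T}. G (\<rho> t) * ennreal (mderiv p {0..T} \<rho> t) \<partial>lebesgue) < \<infinity>
      \<longrightarrow> (\<exists>\<phi>. (AE t\<in>{0..T} in lebesgue. E (\<rho> t) = ereal (\<phi> t)) \<and>
               finite_variation_on \<phi> 0 T \<and>
               (AE t\<in>{0..T} in lebesgue. \<exists>D. (\<phi> has_real_derivative D) (at t within {0..T}) \<and>
                    ennreal \<bar>D\<bar> \<le> G (\<rho> t) * ennreal (mderiv p {0..T} \<rho> t))))"

definition max_slope_curve ::
  "real \<Rightarrow> (('a::polish_space) measure \<Rightarrow> ereal) \<Rightarrow> ('a measure \<Rightarrow> ennreal) \<Rightarrow> (real \<Rightarrow> 'a measure) \<Rightarrow> bool" where
  "max_slope_curve p E G \<rho> \<longleftrightarrow> AC_infty p \<rho> \<and>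
     (\<exists>\<phi>. (AE t\<in>{0::real..} in lebesgue. E (\<rho> t) = ereal (\<phi> t)) \<and>
          antimono_on {0::real..} \<phi> \<and>
          (AE t\<in>{0::real..} in lebesgue. G (\<rho> t) < \<infinity> \<and>
              (\<phi> has_real_derivative
                 (- ((mderiv p {0::real..} \<rho> t) powr p) / p - ((enn2real (G (\<rho> t))) powr (p/(p-1))) / (p/(p-1))))
              (at t within {0::real..})))"

definition Z_set :: "real \<Rightarrow> (('a::polish_space) measure \<Rightarrow> ereal) \<Rightarrow> 'a measure set" where
  "Z_set p E = {\<mu> \<in> Prob_p p. E \<mu> < \<infinity>}"

definition weak_stationary :: "(('a::polish_space) measure \<Rightarrow> ereal) \<Rightarrow> ('a measure \<Rightarrow> ennreal) \<Rightarrow> 'a measure set" where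
  "weak_stationary Et Gt = {\<mu> \<in> Prob. Et \<mu> < \<infinity> \<and> Gt \<mu> = 0}"

end

theory Submission
  imports Defs
begin

text \<open>Along a curve of maximal slope the energy decreases at rate \<open>\<bar>\<rho>'\<bar>\<^sup>p/p + G\<^sup>q/q\<close> and is bounded
  below, so the dissipation over \<open>[t, t + 1]\<close> vanishes as \<open>t \<rightarrow> \<infinity>\<close>. Hence some \<open>s \<in> [t, t + 1]\<close> has small
  slope \<open>G(\<rho>(s))\<close>, and \<open>W\<^sub>p(\<rho>(t), \<rho>(s)) \<le> \<integral> \<bar>\<rho>'\<bar>\<close> is small as well. Compactness of the sublevels and lower
  semicontinuity of energy and slope show that limits of \<open>\<rho>(s)\<close>, and therefore of \<open>\<rho>(t)\<close>, are weak
  stationary states.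

  The metric derivative in the definition of the curve is a limit operator, which is meaningful
  only where the limit exists. The inequality \<open>W\<^sub>p(\<rho>(t), \<rho>(s)) \<le> \<integral> \<bar>\<rho>'\<bar>\<close> therefore rests on the almost
  everywhere existence of the metric derivative, which in turn needs the triangle inequality for
  the Wasserstein distance.\<close>

section \<open>The Levy--Prokhorov distance\<close>

text \<open>Two obstacles shape the argument. The slope is small only at some nearby time
  \<open>s\<close>, not at a prescribed \<open>t\<close>, and the energy agrees with the monotone
  function \<open>\<phi>\<close> only almost everywhere. Compactness is therefore applied at well
  chosen times, and the Wasserstein estimate carries the limit back to \<open>t\<close>. The narrow
  limits may have infinite p-th moment, which is why stationarity is expressed through the
  extensions \<open>Et\<close> and \<open>Gt\<close>. Nothing says that \<open>\<phi>\<close> is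
  absolutely continuous: it may jump, so the energy drop only bounds the dissipation from above. Nor
  is \<open>G \<circ> \<rho>\<close> known to be measurable, so the dissipation is integrated
  through a measurable function that agrees with it almost everywhere. Two pointwise inequalities
  with constant weights replace integral ones: x <= e + e^(1-p) x^p stands in for Hoelder when
  distance is compared with dissipation, and a weighted Jensen inequality stands in for Minkowski in
  the triangle inequality.\<close>

lemma nbhd_eq_Union_ball: "nbhd A e = (\<Union>y\<in>A. ball y e)"
  by (auto simp: nbhd_def dist_commute)

lemma nbhd_borel [measurable]: "nbhd A e \<in> sets borel"
  by (auto simp: nbhd_eq_Union_ball intro!: borel_open)

lemma nbhd_mono: "d \<le> e \<Longrightarrow> nbhd A d \<subseteq> nbhd A e"
  by (auto simp: nbhd_def intro: less_le_trans)

lemma nbhd_nbhd: "nbhd (nbhd A d) e \<subseteq> nbhd A (d + e)"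
proof
  fix x assume "x \<in> nbhd (nbhd A d) e"
  then obtain y z where "z \<in> A" "dist y z < d" "dist x y < e" by (auto simp: nbhd_def)
  moreover have "dist x z \<le> dist x y + dist y z" by (rule dist_triangle)
  ultimately show "x \<in> nbhd A (d + e)" by (force simp: nbhd_def)
qed

lemma ProbD: assumes "\<mu> \<in> Prob" shows "prob_space \<mu>" "sets \<mu> = sets borel" "space \<mu> = UNIV"
  using assms sets_eq_imp_space_eq[of \<mu> borel] by (auto simp: Prob_def)

text \<open>The admissible radii form an upward closed set of positive numbers, so each claim about
  the infimum \<open>dLP\<close> reduces to a claim about single radii.\<close>

definition LP_bound :: "'a::polish_space measure \<Rightarrow> 'a measure \<Rightarrow> real \<Rightarrow> bool" where
  "LP_bound \<mu> \<nu> e \<longleftrightarrow> e > 0 \<and> (\<forall>A \<in> sets borel.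
       measure \<mu> A \<le> measure \<nu> (nbhd A e) + e \<and> measure \<nu> A \<le> measure \<mu> (nbhd A e) + e)"

lemma dLP_eq_Inf: "dLP \<mu> \<nu> = Inf {e. LP_bound \<mu> \<nu> e}"
  by (simp add: dLP_def LP_bound_def)

text \<open>Probabilities never exceed 1. This witness makes the infimum in \<open>dLP\<close> run
  over a nonempty set; the real \<open>Inf\<close> of an empty set carries no information.\<close>

lemma LP_bound_one:
  assumes "\<mu> \<in> Prob" "\<nu> \<in> Prob" shows "LP_bound \<mu> \<nu> 1"
proof -
  interpret \<mu>: prob_space \<mu> using assms ProbD by blast
  interpret \<nu>: prob_space \<nu> using assms ProbD by blast
  show ?thesis unfolding LP_bound_def
    by (auto intro: add_increasing)
qed

lemma LP_bound_mono:
  assumes "\<mu> \<in> Prob" "\<nu> \<in> Prob" "LP_bound \<mu> \<nu> d" "d \<le> e" shows "LP_bound \<mu> \<nu> e"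
proof -
  interpret \<mu>: prob_space \<mu> using assms ProbD by blast
  interpret \<nu>: prob_space \<nu> using assms ProbD by blast
  have "measure \<mu> (nbhd A d) \<le> measure \<mu> (nbhd A e)" "measure \<nu> (nbhd A d) \<le> measure \<nu> (nbhd A e)" for A
    using assms by (auto intro!: \<mu>.finite_measure_mono \<nu>.finite_measure_mono nbhd_mono simp: ProbD)
  then show ?thesis using assms(3,4) unfolding LP_bound_def
    by (smt (verit, best))
qed

text \<open>The two inequalities enlarge \<open>A\<close> in opposite orders, by \<open>d\<close>
  then \<open>e\<close> and by \<open>e\<close> then \<open>d\<close>. The intermediate enlargement
  is open, hence an admissible test set, and both results lie in the enlargement by
  \<open>d + e\<close>.\<close>

lemma LP_bound_trans:
  assumes "\<mu> \<in> Prob" "\<nu> \<in> Prob" "\<sigma> \<in> Prob" "LP_bound \<mu> \<nu> d" "LP_bound \<nu> \<sigma> e"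
  shows "LP_bound \<mu> \<sigma> (d + e)"
proof -
  interpret \<mu>: prob_space \<mu> using assms ProbD by blast
  interpret \<sigma>: prob_space \<sigma> using assms ProbD by blast
  have "measure \<sigma> (nbhd (nbhd A d) e) \<le> measure \<sigma> (nbhd A (d + e))"
       "measure \<mu> (nbhd (nbhd A e) d) \<le> measure \<mu> (nbhd A (d + e))" for A
    using assms nbhd_nbhd[of A d e] nbhd_nbhd[of A e d]
    by (auto intro!: \<mu>.finite_measure_mono \<sigma>.finite_measure_mono simp: ProbD add.commute)
  then show ?thesis using assms(4,5) unfolding LP_bound_def
    by (smt (verit, best) nbhd_borel)
qed

lemma dLP_le: "LP_bound \<mu> \<nu> e \<Longrightarrow> dLP \<mu> \<nu> \<le> e"
  unfolding dLP_eq_Inf by (intro cInf_lower bdd_belowI[of _ 0]) (auto simp: LP_bound_def)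

lemma dLP_nonneg:
  assumes "\<mu> \<in> Prob" "\<nu> \<in> Prob" shows "0 \<le> dLP \<mu> \<nu>"
  unfolding dLP_eq_Inf using LP_bound_one[OF assms]
  by (intro cInf_greatest) (blast, simp add: LP_bound_def)

lemma LP_bound_if_dLP_less:
  assumes "\<mu> \<in> Prob" "\<nu> \<in> Prob" "dLP \<mu> \<nu> < e" shows "LP_bound \<mu> \<nu> e"
proof -
  have "\<exists>d\<in>{e. LP_bound \<mu> \<nu> e}. d < e"
    using assms LP_bound_one[OF assms(1,2)] by (intro cInf_lessD) (auto simp: dLP_eq_Inf)
  then show ?thesis using LP_bound_mono assms by fastforce
qed

lemma dLP_triangle:
  assumes "\<mu> \<in> Prob" "\<nu> \<in> Prob" "\<sigma> \<in> Prob"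
  shows "dLP \<mu> \<sigma> \<le> dLP \<mu> \<nu> + dLP \<nu> \<sigma>"
proof (rule field_le_epsilon)
  fix e :: real assume "e > 0"
  then have "LP_bound \<mu> \<nu> (dLP \<mu> \<nu> + e/2)" "LP_bound \<nu> \<sigma> (dLP \<nu> \<sigma> + e/2)"
    using assms by (auto intro!: LP_bound_if_dLP_less)
  from dLP_le[OF LP_bound_trans[OF assms this]]
  show "dLP \<mu> \<sigma> \<le> dLP \<mu> \<nu> + dLP \<nu> \<sigma> + e" by simp
qed

section \<open>The Wasserstein distance\<close>

lemma couplingsD:
  assumes "\<pi> \<in> couplings \<mu> \<nu>"
  shows "prob_space \<pi>" "sets \<pi> = sets borel" "space \<pi> = UNIV"
    "distr \<pi> borel fst = \<mu>" "distr \<pi> borel snd = \<nu>"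
  using assms sets_eq_imp_space_eq[of \<pi> borel] by (auto simp: couplings_def)


text \<open>\<open>couplings\<close> refers to the Borel sets of the product space, while
  measurability of the projections is phrased with the product sigma-algebra. On a second countable
  space the two coincide.\<close>

lemma sets_coupling:
  fixes \<mu> \<nu> :: "'a::polish_space measure"
  assumes "\<pi> \<in> couplings \<mu> \<nu>"
  shows "sets \<pi> = sets (borel \<Otimes>\<^sub>M borel)"
  using couplingsD(2)[OF assms] unfolding borel_prod .

lemma nn_integral_coupling_fst:
  fixes \<mu> \<nu> :: "'a::polish_space measure"
  assumes "\<pi> \<in> couplings \<mu> \<nu>" and [measurable]: "f \<in> borel_measurable borel"
  shows "(\<integral>\<^sup>+z. f (fst z) \<partial>\<pi>) = (\<integral>\<^sup>+x. f x \<partial>\<mu>)"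
proof -
  have [measurable_cong]: "sets \<pi> = sets (borel \<Otimes>\<^sub>M borel)"
    by (rule sets_coupling[OF assms(1)])
  show ?thesis
    unfolding couplingsD(4)[OF assms(1), symmetric] by (subst nn_integral_distr) auto
qed

lemma nn_integral_coupling_snd:
  fixes \<mu> \<nu> :: "'a::polish_space measure"
  assumes "\<pi> \<in> couplings \<mu> \<nu>" and [measurable]: "f \<in> borel_measurable borel"
  shows "(\<integral>\<^sup>+z. f (snd z) \<partial>\<pi>) = (\<integral>\<^sup>+x. f x \<partial>\<nu>)"
proof -
  have [measurable_cong]: "sets \<pi> = sets (borel \<Otimes>\<^sub>M borel)"
    by (rule sets_coupling[OF assms(1)])
  show ?thesis
    unfolding couplingsD(5)[OF assms(1), symmetric] by (subst nn_integral_distr) auto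
qed

lemma couplings_swap:
  fixes \<mu> \<nu> :: "'a::polish_space measure"
  assumes "\<pi> \<in> couplings \<mu> \<nu>"
  shows "distr \<pi> borel prod.swap \<in> couplings \<nu> \<mu>"
proof -
  have [measurable_cong]: "sets \<pi> = sets (borel \<Otimes>\<^sub>M borel)"
    by (rule sets_coupling[OF assms(1)])
  have [measurable]: "prod.swap \<in> \<pi> \<rightarrow>\<^sub>M (borel :: ('a \<times> 'a) measure)"
    unfolding prod.swap_def borel_prod[symmetric] by measurable
  have [measurable]: "fst \<in> (borel :: ('a \<times> 'a) measure) \<rightarrow>\<^sub>M borel" "snd \<in> (borel :: ('a \<times> 'a) measure) \<rightarrow>\<^sub>M borel"
    unfolding borel_prod[symmetric] by measurable
  show ?thesis
    using couplingsD[OF assms] unfolding couplings_def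
    by (auto simp: distr_distr comp_def intro!: prob_space.prob_space_distr)
qed

lemma nn_integral_coupling_swap:
  fixes \<mu> \<nu> :: "'a::polish_space measure"
  assumes "\<pi> \<in> couplings \<mu> \<nu>"
  shows "(\<integral>\<^sup>+ z. ennreal (dist (fst z) (snd z) powr p) \<partial>distr \<pi> borel prod.swap) =
    (\<integral>\<^sup>+ z. ennreal (dist (fst z) (snd z) powr p) \<partial>\<pi>)"
proof -
  have [measurable_cong]: "sets \<pi> = sets (borel \<Otimes>\<^sub>M borel)"
    by (rule sets_coupling[OF assms(1)])
  have [measurable]: "prod.swap \<in> \<pi> \<rightarrow>\<^sub>M (borel :: ('a \<times> 'a) measure)"
    unfolding prod.swap_def borel_prod[symmetric] by measurable
  have [measurable]: "fst \<in> (borel :: ('a \<times> 'a) measure) \<rightarrow>\<^sub>M borel" "snd \<in> (borel :: ('a \<times> 'a) measure) \<rightarrow>\<^sub>M borel"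
    unfolding borel_prod[symmetric] by measurable
  show ?thesis by (subst nn_integral_distr) (auto simp: dist_commute)
qed

lemma Wass_sym:
  fixes \<mu> \<nu> :: "'a::polish_space measure"
  shows "Wass p \<mu> \<nu> = Wass p \<nu> \<mu>"
proof -
  have "(INF \<pi>\<in>couplings \<mu> \<nu>. \<integral>\<^sup>+ z. ennreal (dist (fst z) (snd z) powr p) \<partial>\<pi>) \<le>
        (INF \<pi>\<in>couplings \<nu> \<mu>. \<integral>\<^sup>+ z. ennreal (dist (fst z) (snd z) powr p) \<partial>\<pi>)" for \<mu> \<nu> :: "'a measure"
    by (intro INF_greatest INF_lower2[OF couplings_swap]) (auto simp: nn_integral_coupling_swap)
  from antisym[OF this this] show ?thesis unfolding Wass_def by (rule arg_cong)
qed

lemma Wass_nonneg: "0 \<le> Wass p \<mu> \<nu>"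
  by (simp add: Wass_def)

lemma pair_measure_couplings:
  fixes \<mu> \<nu> :: "'a::polish_space measure"
  assumes "\<mu> \<in> Prob" "\<nu> \<in> Prob"
  shows "\<mu> \<Otimes>\<^sub>M \<nu> \<in> couplings \<mu> \<nu>"
proof -
  interpret \<mu>: prob_space \<mu> using assms ProbD by blast
  interpret \<nu>: prob_space \<nu> using assms ProbD by blast
  interpret pair_prob_space \<mu> \<nu> ..
  have s: "sets \<mu> = sets borel" "sets \<nu> = sets borel" using assms by (simp_all add: ProbD)
  have "sets (\<mu> \<Otimes>\<^sub>M \<nu>) = sets borel"
    unfolding borel_prod[symmetric] by (rule sets_pair_measure_cong[OF s])
  moreover have "distr (\<mu> \<Otimes>\<^sub>M \<nu>) borel fst = \<mu>"
    using distr_cong[OF refl s(1), of "\<mu> \<Otimes>\<^sub>M \<nu>" fst fst] \<nu>.distr_pair_fst[of \<mu>] \<nu>.emeasure_space_1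
    by (simp add: scale_measure_1)
  moreover have "distr (\<mu> \<Otimes>\<^sub>M \<nu>) borel snd = \<nu>"
  proof (rule measure_eqI)
    fix A assume "A \<in> sets (distr (\<mu> \<Otimes>\<^sub>M \<nu>) borel snd)"
    then have A: "A \<in> sets \<nu>" by (simp add: s)
    have "snd -` A \<inter> space (\<mu> \<Otimes>\<^sub>M \<nu>) = space \<mu> \<times> A"
      using sets.sets_into_space[OF A] by (auto simp: space_pair_measure)
    moreover have "snd \<in> \<mu> \<Otimes>\<^sub>M \<nu> \<rightarrow>\<^sub>M borel"
      using measurable_snd[of \<mu> \<nu>] by (simp add: s cong: measurable_cong_sets)
    ultimately show "emeasure (distr (\<mu> \<Otimes>\<^sub>M \<nu>) borel snd) A = emeasure \<nu> A"
      using A \<nu>.emeasure_pair_measure_Times[OF sets.top A, of \<mu>]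
      by (simp add: emeasure_distr s \<mu>.emeasure_space_1)
  qed (simp add: s)
  ultimately show ?thesis
    unfolding couplings_def using prob_space_axioms by auto
qed

text \<open>Each summand is at most the largest one. The crude constant suffices where only
  finiteness of a cost is at stake.\<close>

lemma powr_sum3_le:
  fixes x y z p :: real
  assumes "0 \<le> x" "0 \<le> y" "0 \<le> z" "0 \<le> p"
  shows "(x + y + z) powr p \<le> 3 powr p * (x powr p + y powr p + z powr p)"
proof -
  define M where "M = max x (max y z)"
  have "(x + y + z) powr p \<le> (3 * M) powr p"
    using assms by (intro powr_mono2) (auto simp: M_def)
  also have "\<dots> = 3 powr p * M powr p" by (simp add: powr_mult)
  also have "M powr p \<le> x powr p + y powr p + z powr p"
    by (auto simp: M_def max_def)
  finally show ?thesis by (simp add: mult_left_mono)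
qed

text \<open>The product coupling has finite cost, by comparison with the base points of the two
  moments. This matters because \<open>enn2real\<close> in \<open>Wass\<close> would turn an
  infinite infimum into distance 0; only a finite one can be recovered from
  \<open>Wass\<close>.\<close>

lemma finite_cost_coupling:
  fixes \<mu> \<nu> :: "'a::polish_space measure"
  assumes "\<mu> \<in> Prob_p p" "\<nu> \<in> Prob_p p" "0 \<le> p"
  shows "(INF \<pi>\<in>couplings \<mu> \<nu>. \<integral>\<^sup>+ z. ennreal (dist (fst z) (snd z) powr p) \<partial>\<pi>) < \<infinity>"
proof -
  have P: "\<mu> \<in> Prob" "\<nu> \<in> Prob" using assms by (auto simp: Prob_p_def)
  obtain x0 y0 where fin: "(\<integral>\<^sup>+ x. ennreal (dist x x0 powr p) \<partial>\<mu>) < \<infinity>" "(\<integral>\<^sup>+ x. ennreal (dist x y0 powr p) \<partial>\<nu>) < \<infinity>"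
    using assms by (auto simp: Prob_p_def)
  define \<pi> where "\<pi> = \<mu> \<Otimes>\<^sub>M \<nu>"
  have \<pi>: "\<pi> \<in> couplings \<mu> \<nu>" unfolding \<pi>_def by (rule pair_measure_couplings[OF P])
  interpret \<pi>: prob_space \<pi> using couplingsD[OF \<pi>] by simp
  have [measurable_cong]: "sets \<pi> = sets (borel \<Otimes>\<^sub>M borel)"
    by (rule sets_coupling[OF \<pi>])
  have "(\<integral>\<^sup>+ z. ennreal (dist (fst z) (snd z) powr p) \<partial>\<pi>) \<le>
    (\<integral>\<^sup>+ z. ennreal (3 powr p) * (ennreal (dist (fst z) x0 powr p) + ennreal (dist (snd z) y0 powr p) + ennreal (dist x0 y0 powr p)) \<partial>\<pi>)"
  proof (rule nn_integral_mono)
    fix z :: "'a \<times> 'a"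
    have "dist (fst z) (snd z) \<le> dist (fst z) x0 + dist (snd z) y0 + dist x0 y0"
      by (smt (verit) dist_commute dist_triangle)
    then have "dist (fst z) (snd z) powr p \<le> (dist (fst z) x0 + dist (snd z) y0 + dist x0 y0) powr p"
      using assms(3) by (intro powr_mono2) auto
    also have "\<dots> \<le> 3 powr p * (dist (fst z) x0 powr p + dist (snd z) y0 powr p + dist x0 y0 powr p)"
      using assms(3) by (intro powr_sum3_le) auto
    finally show "ennreal (dist (fst z) (snd z) powr p) \<le> ennreal (3 powr p) * (ennreal (dist (fst z) x0 powr p) + ennreal (dist (snd z) y0 powr p) + ennreal (dist x0 y0 powr p))"
      by (simp add: ennreal_mult[symmetric] ennreal_plus[symmetric] ennreal_leI del: ennreal_plus)
  qed
  also have "\<dots> = ennreal (3 powr p) * ((\<integral>\<^sup>+ z. ennreal (dist (fst z) x0 powr p) \<partial>\<pi>)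
      + (\<integral>\<^sup>+ z. ennreal (dist (snd z) y0 powr p) \<partial>\<pi>) + ennreal (dist x0 y0 powr p))"
    by (simp add: nn_integral_cmult nn_integral_add \<pi>.emeasure_space_1)
  also have "\<dots> = ennreal (3 powr p) * ((\<integral>\<^sup>+ z. ennreal (dist z x0 powr p) \<partial>\<mu>)
      + (\<integral>\<^sup>+ z. ennreal (dist z y0 powr p) \<partial>\<nu>) + ennreal (dist x0 y0 powr p))"
    using nn_integral_coupling_fst[OF \<pi>, of "\<lambda>x. ennreal (dist x x0 powr p)"]
      nn_integral_coupling_snd[OF \<pi>, of "\<lambda>x. ennreal (dist x y0 powr p)"] by simp
  also have "\<dots> < \<infinity>" using fin by (simp add: ennreal_mult_less_top)
  finally show ?thesis using \<pi> by (meson INF_lower le_less_trans)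
qed

lemma Wass_le:
  fixes \<mu> \<nu> :: "'a::polish_space measure"
  assumes "0 < p" "\<pi> \<in> couplings \<mu> \<nu>" "0 \<le> c"
    "(\<integral>\<^sup>+ z. ennreal (dist (fst z) (snd z) powr p) \<partial>\<pi>) \<le> ennreal (c powr p)"
  shows "Wass p \<mu> \<nu> \<le> c"
proof -
  have "(INF \<pi>\<in>couplings \<mu> \<nu>. \<integral>\<^sup>+ z. ennreal (dist (fst z) (snd z) powr p) \<partial>\<pi>) \<le> ennreal (c powr p)"
    using assms by (meson INF_lower2)
  then have "enn2real (INF \<pi>\<in>couplings \<mu> \<nu>. \<integral>\<^sup>+ z. ennreal (dist (fst z) (snd z) powr p) \<partial>\<pi>) \<le> c powr p"
    by (simp add: enn2real_leI)
  then have "Wass p \<mu> \<nu> \<le> (c powr p) powr (1/p)"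
    unfolding Wass_def using assms by (intro powr_mono2) auto
  also have "\<dots> = c" using assms by (simp add: powr_powr)
  finally show ?thesis .
qed

lemma Wass_lessD:
  fixes \<mu> \<nu> :: "'a::polish_space measure"
  assumes "0 < p" "\<mu> \<in> Prob_p p" "\<nu> \<in> Prob_p p" "Wass p \<mu> \<nu> < c"
  obtains \<pi> where "\<pi> \<in> couplings \<mu> \<nu>"
    "(\<integral>\<^sup>+ z. ennreal (dist (fst z) (snd z) powr p) \<partial>\<pi>) < ennreal (c powr p)"
proof -
  define I where "I = (INF \<pi>\<in>couplings \<mu> \<nu>. \<integral>\<^sup>+ z. ennreal (dist (fst z) (snd z) powr p) \<partial>\<pi>)"
  have I: "I < \<infinity>" unfolding I_def using assms by (intro finite_cost_coupling) auto
  have "enn2real I powr (1/p) < c" using assms(4) by (simp add: Wass_def I_def)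
  then have "(enn2real I powr (1/p)) powr p < c powr p" using assms(1) by (intro powr_less_mono2) auto
  then have "enn2real I < c powr p" using assms(1) by (simp add: powr_powr)
  then have "I < ennreal (c powr p)"
    using I by (metis ennreal_enn2real ennreal_lessI enn2real_nonneg infinity_ennreal_def le_less_trans)
  then show thesis using that unfolding I_def INF_less_iff by auto
qed

text \<open>Markov's inequality for the distance under an almost optimal coupling.\<close>
lemma LP_bound_if_Wass:
  fixes \<mu> \<nu> :: "'a::polish_space measure"
  assumes "0 < p" "\<mu> \<in> Prob_p p" "\<nu> \<in> Prob_p p" "0 < e" "Wass p \<mu> \<nu> < e powr (1 + 1/p)"
  shows "LP_bound \<mu> \<nu> e"
proof -
  obtain \<pi> where \<pi>: "\<pi> \<in> couplings \<mu> \<nu>"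
    and c: "(\<integral>\<^sup>+ z. ennreal (dist (fst z) (snd z) powr p) \<partial>\<pi>) < ennreal ((e powr (1 + 1/p)) powr p)"
    using Wass_lessD[OF assms(1,2,3,5)] .
  interpret \<pi>: prob_space \<pi> using couplingsD[OF \<pi>] by simp
  have [measurable_cong]: "sets \<pi> = sets (borel \<Otimes>\<^sub>M borel)"
    by (rule sets_coupling[OF \<pi>])
  have sp: "space \<pi> = UNIV" using couplingsD[OF \<pi>] by simp
  define D where "D = {z\<in>space \<pi>. e \<le> dist (fst z) (snd z)}"
  have [measurable]: "D \<in> sets \<pi>" unfolding D_def by measurable
  have "ennreal (e powr p) * emeasure \<pi> D = (\<integral>\<^sup>+ z. ennreal (e powr p) * indicator D z \<partial>\<pi>)"
    by (simp add: nn_integral_cmult_indicator)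
  also have "\<dots> \<le> (\<integral>\<^sup>+ z. ennreal (dist (fst z) (snd z) powr p) \<partial>\<pi>)"
    using assms(1,4) by (intro nn_integral_mono) (auto simp: D_def indicator_def intro!: ennreal_leI powr_mono2)
  also have "\<dots> \<le> ennreal ((e powr (1 + 1/p)) powr p)"
    using c by simp
  \<comment> \<open>The exponent 1 + 1/p is chosen for this: the cost is below e^p * e, and the
    factor e^p is what Markov's inequality divides out, leaving mass at most \<open>e\<close> on
    \<open>D\<close>.\<close>
  also have "(e powr (1 + 1/p)) powr p = e powr p * e"
  proof -
    have "(1 + 1/p) * p = p + 1" using assms(1) by (simp add: field_simps)
    then show ?thesis using assms(4) by (metis powr_add powr_one powr_powr order_less_imp_le)
  qed
  finally have "ennreal (e powr p * measure \<pi> D) \<le> ennreal (e powr p * e)"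
    unfolding \<pi>.emeasure_eq_measure by (subst ennreal_mult) (simp_all only: powr_ge_zero measure_nonneg)
  then have "e powr p * measure \<pi> D \<le> e powr p * e"
    using assms(4) by (subst (asm) ennreal_le_iff) auto
  then have De: "measure \<pi> D \<le> e" using assms(4) by simp
  have f: "measure \<mu> A = measure \<pi> (fst -` A \<inter> space \<pi>)" if "A \<in> sets borel" for A
  proof -
    have "measure (distr \<pi> borel fst) A = measure \<pi> (fst -` A \<inter> space \<pi>)"
      using that by (intro measure_distr) simp_all
    then show ?thesis by (simp only: couplingsD(4)[OF \<pi>])
  qed
  have g: "measure \<nu> A = measure \<pi> (snd -` A \<inter> space \<pi>)" if "A \<in> sets borel" for A
  proof -
    have "measure (distr \<pi> borel snd) A = measure \<pi> (snd -` A \<inter> space \<pi>)"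
      using that by (intro measure_distr) simp_all
    then show ?thesis by (simp only: couplingsD(5)[OF \<pi>])
  qed
  have "measure \<mu> A \<le> measure \<nu> (nbhd A e) + e" if [measurable]: "A \<in> sets borel" for A
  proof -
    have "fst -` A \<inter> space \<pi> \<subseteq> (snd -` nbhd A e \<inter> space \<pi>) \<union> D"
    proof
      fix z assume z: "z \<in> fst -` A \<inter> space \<pi>"
      show "z \<in> (snd -` nbhd A e \<inter> space \<pi>) \<union> D"
      proof (cases "dist (snd z) (fst z) < e")
        case True
        then have "snd z \<in> nbhd A e" using z unfolding nbhd_def by blast
        then show ?thesis using z by simp
      next
        case False
        then show ?thesis using z by (simp add: D_def dist_commute not_less)
      qed
    qed
    then have "measure \<pi> (fst -` A \<inter> space \<pi>) \<le> measure \<pi> ((snd -` nbhd A e \<inter> space \<pi>) \<union> D)"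
      by (intro \<pi>.finite_measure_mono) measurable
    also have "\<dots> \<le> measure \<pi> (snd -` nbhd A e \<inter> space \<pi>) + measure \<pi> D"
      by (intro measure_Un_le) measurable
    finally show ?thesis using De that by (simp only: f g nbhd_borel)
  qed
  moreover have "measure \<nu> A \<le> measure \<mu> (nbhd A e) + e" if [measurable]: "A \<in> sets borel" for A
  proof -
    have "snd -` A \<inter> space \<pi> \<subseteq> (fst -` nbhd A e \<inter> space \<pi>) \<union> D"
    proof
      fix z assume z: "z \<in> snd -` A \<inter> space \<pi>"
      show "z \<in> (fst -` nbhd A e \<inter> space \<pi>) \<union> D"
      proof (cases "dist (fst z) (snd z) < e")
        case True
        then have "fst z \<in> nbhd A e" using z unfolding nbhd_def by blast
        then show ?thesis using z by simp
      next
        case False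
        then show ?thesis using z by (simp add: D_def dist_commute not_less)
      qed
    qed
    then have "measure \<pi> (snd -` A \<inter> space \<pi>) \<le> measure \<pi> ((fst -` nbhd A e \<inter> space \<pi>) \<union> D)"
      by (intro \<pi>.finite_measure_mono) measurable
    also have "\<dots> \<le> measure \<pi> (fst -` nbhd A e \<inter> space \<pi>) + measure \<pi> D"
      by (intro measure_Un_le) measurable
    finally show ?thesis using De that by (simp only: f g nbhd_borel)
  qed
  ultimately show ?thesis using assms(4) unfolding LP_bound_def by blast
qed

lemma Wass_refl:
  fixes \<mu> :: "'a::polish_space measure"
  assumes "0 < p" "\<mu> \<in> Prob" shows "Wass p \<mu> \<mu> = 0"
proof -
  interpret \<mu>: prob_space \<mu> using assms ProbD by blast
  have s [measurable_cong]: "sets \<mu> = sets borel" using assms by (simp add: ProbD)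
  define \<pi> where "\<pi> = distr \<mu> (borel \<Otimes>\<^sub>M borel) (\<lambda>x. (x, x))"
  have "distr \<pi> borel fst = \<mu>" "distr \<pi> borel snd = \<mu>"
    unfolding \<pi>_def by (simp_all add: distr_distr comp_def distr_id2 s)
  moreover have "sets \<pi> = sets borel" unfolding \<pi>_def borel_prod by simp
  moreover have "prob_space \<pi>" unfolding \<pi>_def by (intro \<mu>.prob_space_distr) measurable
  ultimately have "\<pi> \<in> couplings \<mu> \<mu>" by (simp add: couplings_def)
  moreover have "(\<integral>\<^sup>+ z. ennreal (dist (fst z) (snd z) powr p) \<partial>\<pi>) = 0"
    unfolding \<pi>_def by (subst nn_integral_distr) (auto simp: measurable_split_conv)
  ultimately have "Wass p \<mu> \<mu> \<le> 0" using assms(1) by (intro Wass_le) auto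
  then show ?thesis using Wass_nonneg[of p \<mu> \<mu>] by simp
qed

section \<open>Gluing of couplings and the triangle inequality\<close>

text \<open>Jensen for the p-th power at the points x/a and y/b with weights a/(a+b) and b/(a+b). If
  x^p and y^p integrate to at most a^p and b^p, the right-hand side integrates to at most (a+b)^p;
  this yields Minkowski's inequality from a pointwise one.\<close>

lemma powr_add_convex:
  fixes x y a b p :: real
  assumes "0 \<le> x" "0 \<le> y" "0 < a" "0 < b" "1 \<le> p"
  shows "(x + y) powr p \<le> (a + b) powr (p - 1) * (a powr (1 - p) * x powr p + b powr (1 - p) * y powr p)"
proof -
  have jensen: "((1 - t) * u + t * v) powr p \<le> (1 - t) * u powr p + t * v powr p"
    if "0 \<le> u" "0 \<le> v" "0 < t" "t < 1" for u v t :: real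
  proof (cases "u = 0 \<or> v = 0")
    case False
    then show ?thesis
      using convex_onD[OF powr_convex[OF assms(5)], of t u v] that by simp
  next
    case True
    \<comment> \<open>When one argument vanishes, Jensen's inequality reduces to s^p <= s for the
      weight \<open>s\<close> of the other one.\<close>
    have "s powr p \<le> s" if "0 < s" "s < 1" for s :: real
      using powr_mono'[of 1 p s] that assms(5) by simp
    from this[of t] this[of "1 - t"] True that show ?thesis
      by (auto simp: powr_mult intro!: mult_right_mono)
  qed
  define t where "t = b / (a + b)"
  have t: "0 < t" "t < 1" "1 - t = a / (a + b)" using assms by (auto simp: t_def field_simps)
  have "(1 - t) * (x / a) + t * (y / b) = (x + y) / (a + b)"
    unfolding t using assms by (simp add: t_def add_divide_distrib)
  then have "((x + y) / (a + b)) powr p \<le> (1 - t) * (x / a) powr p + t * (y / b) powr p"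
    using jensen[of "x / a" "y / b" t] assms t by simp
  then have "(a + b) powr p * ((x + y) / (a + b)) powr p \<le> (a + b) powr p * ((1 - t) * (x / a) powr p + t * (y / b) powr p)"
    by (intro mult_left_mono) auto
  also have "(a + b) powr p * ((x + y) / (a + b)) powr p = (x + y) powr p"
    using assms by (simp add: powr_mult[symmetric])
  also have "(a + b) powr p * ((1 - t) * (x / a) powr p + t * (y / b) powr p) =
      (a + b) powr (p - 1) * (a powr (1 - p) * x powr p + b powr (1 - p) * y powr p)"
  proof -
    have "S powr p * (c / S * (z / c) powr p) = S powr (p - 1) * (c powr (1 - p) * z powr p)"
      if "0 < S" "0 < c" "0 \<le> z" for S c z :: real
      using that by (simp add: powr_divide powr_diff)
    from this[of "a + b" a x] this[of "a + b" b y] show ?thesis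
      using assms unfolding t(3) unfolding t_def by (simp add: distrib_left)
  qed
  finally show ?thesis .
qed

text \<open>The third summand is there for the gap between the two middle points of the approximate
  gluing. Splitting off \<open>z\<close> first and then separating \<open>x\<close> from
  \<open>y\<close>, the powers of a + b cancel.\<close>

lemma powr_add3_convex:
  fixes x y z a b c p :: real
  assumes "0 \<le> x" "0 \<le> y" "0 \<le> z" "0 < a" "0 < b" "0 < c" "1 \<le> p"
  shows "(x + y + z) powr p \<le> (a + b + c) powr (p - 1) *
    (a powr (1 - p) * x powr p + b powr (1 - p) * y powr p + c powr (1 - p) * z powr p)"
proof -
  have "(x + y + z) powr p \<le> (a + b + c) powr (p - 1) *
      ((a + b) powr (1 - p) * (x + y) powr p + c powr (1 - p) * z powr p)"
    using assms by (intro powr_add_convex) auto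
  also have "\<dots> \<le> (a + b + c) powr (p - 1) * ((a + b) powr (1 - p) *
      ((a + b) powr (p - 1) * (a powr (1 - p) * x powr p + b powr (1 - p) * y powr p)) + c powr (1 - p) * z powr p)"
    using assms by (intro mult_left_mono add_right_mono powr_add_convex) auto
  also have "(a + b) powr (1 - p) * ((a + b) powr (p - 1) * (a powr (1 - p) * x powr p + b powr (1 - p) * y powr p))
      = a powr (1 - p) * x powr p + b powr (1 - p) * y powr p"
    using assms by (simp add: mult.assoc[symmetric] powr_add[symmetric])
  finally show ?thesis .
qed

text \<open>The cell index \<open>k\<close> of a point is the first member of a dense sequence
  within e/2 of it; two points of one cell are close to the same centre.\<close>

lemma countable_Borel_partition:
  assumes "0 < e"
  obtains k :: "'a::polish_space \<Rightarrow> nat"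
  where "k \<in> borel \<rightarrow>\<^sub>M count_space UNIV" "\<forall>x y. k x = k y \<longrightarrow> dist x y < e"
proof -
  obtain D :: "'a set" where D: "countable D" "\<And>X. open X \<Longrightarrow> X \<noteq> {} \<Longrightarrow> \<exists>d\<in>D. d \<in> X"
    using countable_dense_exists by blast
  have "D \<noteq> {}" using D(2)[of UNIV] by auto
  define d where "d = from_nat_into D"
  have ex: "\<exists>n. dist x (d n) < e / 2" for x
  proof -
    obtain y where "y \<in> D" "y \<in> ball x (e / 2)"
      using D(2)[of "ball x (e / 2)"] assms by auto
    moreover obtain n where "d n = y"
      using \<open>y \<in> D\<close> D(1) \<open>D \<noteq> {}\<close> unfolding d_def by (metis from_nat_into_surj)
    ultimately show ?thesis by auto
  qed
  define k where "k x = (LEAST n. dist x (d n) < e / 2)" for x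
  have "k \<in> borel \<rightarrow>\<^sub>M count_space UNIV" unfolding k_def by measurable
  moreover have "\<forall>x y. k x = k y \<longrightarrow> dist x y < e"
  proof (intro allI impI)
    fix x y assume that: "k x = k y"
    have "dist x (d (k x)) < e / 2" for x unfolding k_def by (rule LeastI_ex[OF ex])
    from this[of x] this[of y] show "dist x y < e"
      using that dist_triangle_half_l[of x "d (k x)" e y] by simp
  qed
  ultimately show thesis using that by blast
qed

text \<open>An approximate gluing of two couplings along their common marginal \<open>\<nu>\<close>: the middle points
  are only required to lie in the same cell of a fine countable partition. This avoids
  disintegration, since the glued measure then has an explicit density.\<close>
lemma approximate_gluing:
  fixes \<mu> \<nu> \<sigma> :: "'a::polish_space measure"
  assumes \<pi>: "\<pi> \<in> couplings \<mu> \<nu>" and \<tau>: "\<tau> \<in> couplings \<nu> \<sigma>" and \<nu>: "\<nu> \<in> Prob" and "0 < e"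
  obtains \<gamma> where "sets \<gamma> = sets (\<pi> \<Otimes>\<^sub>M \<tau>)"
    "\<forall>f\<in>borel_measurable \<pi>. (\<integral>\<^sup>+z. f (fst z) \<partial>\<gamma>) = (\<integral>\<^sup>+u. f u \<partial>\<pi>)"
    "\<forall>f\<in>borel_measurable \<tau>. (\<integral>\<^sup>+z. f (snd z) \<partial>\<gamma>) = (\<integral>\<^sup>+v. f v \<partial>\<tau>)"
    "AE z in \<gamma>. dist (snd (fst z)) (fst (snd z)) < e"
proof -
  obtain k :: "'a \<Rightarrow> nat" where k [measurable]: "k \<in> borel \<rightarrow>\<^sub>M count_space UNIV"
    and k_dist: "\<forall>x y. k x = k y \<longrightarrow> dist x y < e"
    using countable_Borel_partition[OF \<open>0 < e\<close>] .
  interpret \<nu>: prob_space \<nu> using \<nu> ProbD by blast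
  have [measurable_cong]: "sets \<nu> = sets borel" using \<nu> by (simp add: ProbD)
  interpret \<pi>: prob_space \<pi> using couplingsD[OF \<pi>] by simp
  interpret \<tau>: prob_space \<tau> using couplingsD[OF \<tau>] by simp
  interpret pair_sigma_finite \<pi> \<tau> ..
  have [measurable_cong]: "sets \<pi> = sets (borel \<Otimes>\<^sub>M borel)" "sets \<tau> = sets (borel \<Otimes>\<^sub>M borel)"
    by (rule sets_coupling[OF \<pi>] sets_coupling[OF \<tau>])+
  define c where "c n = measure \<nu> {x. k x = n}" for n
  have cells [measurable]: "{x. k x = n} \<in> sets \<nu>" for n
    using measurable_sets[OF k, of "{n}"] \<nu> by (simp add: vimage_def ProbD)
  \<comment> \<open>With u = (x, y) and v = (y', z), this density restricts the product measure to
    pairs whose middle points y and y' share a cell and divides by the \<open>\<nu>\<close>-mass of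
    that cell: given the cell, the two couplings are combined independently.\<close>
  define h where "h u v = (if k (snd u) = k (fst v) then ennreal (1 / c (k (snd u))) else 0)" for u v :: "'a \<times> 'a"
  have [measurable]: "Measurable.pred (\<pi> \<Otimes>\<^sub>M \<tau>) (\<lambda>z. k (snd (fst z)) = k (fst (snd z)))"
  proof -
    have "Measurable.pred (\<pi> \<Otimes>\<^sub>M \<tau>) (\<lambda>z. \<exists>n. k (fst (snd z)) = n \<and> k (snd (fst z)) = n)"
      by measurable
    then show ?thesis by (simp add: eq_commute)
  qed
  have [measurable]: "c \<in> borel_measurable (count_space UNIV)" by simp
  have h_meas [measurable]: "(\<lambda>(u, v). h u v) \<in> borel_measurable (\<pi> \<Otimes>\<^sub>M \<tau>)"
    unfolding h_def split_beta' by measurable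
  \<comment> \<open>There are only countably many cells, so those of mass zero together form a null
    set. They must be excluded because 1 / 0 = 0 spoils the normalisation there.\<close>
  have c_pos: "AE x in \<nu>. c (k x) > 0"
  proof -
    have "AE x in \<nu>. \<forall>n. c n = 0 \<longrightarrow> k x \<noteq> n"
    proof (unfold AE_all_countable, intro allI)
      fix n show "AE x in \<nu>. c n = 0 \<longrightarrow> k x \<noteq> n"
      proof (cases "c n = 0")
        case True
        then have "{x. k x = n} \<in> null_sets \<nu>"
          using cells[of n] unfolding c_def null_sets_def by (simp add: \<nu>.emeasure_eq_measure)
        from AE_not_in[OF this] show ?thesis by simp
      qed simp
    qed
    then show ?thesis by eventually_elim (metis c_def measure_nonneg order_le_less)
  qed
  have cell: "(\<integral>\<^sup>+ x. (if n = k x then ennreal (1 / c n) else 0) \<partial>\<nu>) = 1" if "c n > 0" for n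
  proof -
    have "(\<integral>\<^sup>+ x. (if n = k x then ennreal (1 / c n) else 0) \<partial>\<nu>) = (\<integral>\<^sup>+ x. ennreal (1 / c n) * indicator {x. k x = n} x \<partial>\<nu>)"
      by (intro nn_integral_cong) (auto simp: indicator_def)
    also have "\<dots> = ennreal (1 / c n) * ennreal (c n)"
      by (subst nn_integral_cmult_indicator) (auto simp: c_def \<nu>.emeasure_eq_measure cells)
    finally show ?thesis using that by (simp add: ennreal_mult[symmetric])
  qed
  have AE_\<pi>: "AE u in \<pi>. c (k (snd u)) > 0"
  proof -
    have "AE x in distr \<pi> borel snd. c (k x) > 0" using c_pos by (simp only: couplingsD(5)[OF \<pi>])
    then show ?thesis by (subst (asm) AE_distr_iff) auto
  qed
  have AE_\<tau>: "AE v in \<tau>. c (k (fst v)) > 0"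
  proof -
    have "AE x in distr \<tau> borel fst. c (k x) > 0" using c_pos by (simp only: couplingsD(4)[OF \<tau>])
    then show ?thesis by (subst (asm) AE_distr_iff) auto
  qed
  \<comment> \<open>For fixed \<open>u\<close> the admissible \<open>v\<close> have mass equal to
    that of the cell, which the density cancels. Together with the symmetric claim \<open>h2\<close>
    this gives \<open>\<gamma>\<close> the marginals \<open>\<pi>\<close> and
    \<open>\<tau>\<close>.\<close>
  have h1: "AE u in \<pi>. (\<integral>\<^sup>+v. h u v \<partial>\<tau>) = 1"
    using AE_\<pi>
  proof eventually_elim
    case (elim u)
    show ?case unfolding h_def
      using nn_integral_coupling_fst[OF \<tau>, of "\<lambda>y. if k (snd u) = k y then ennreal (1 / c (k (snd u))) else 0"] cell[OF elim] by simp
  qed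
  have h2: "AE v in \<tau>. (\<integral>\<^sup>+u. h u v \<partial>\<pi>) = 1"
    using AE_\<tau>
  proof eventually_elim
    case (elim v)
    have "(\<integral>\<^sup>+u. h u v \<partial>\<pi>) = (\<integral>\<^sup>+u. (if k (fst v) = k (snd u) then ennreal (1 / c (k (fst v))) else 0) \<partial>\<pi>)"
      unfolding h_def by (intro nn_integral_cong) auto
    then show ?case
      using nn_integral_coupling_snd[OF \<pi>, of "\<lambda>y. if k (fst v) = k y then ennreal (1 / c (k (fst v))) else 0"] cell[OF elim] by simp
  qed
  define \<gamma> where "\<gamma> = density (\<pi> \<Otimes>\<^sub>M \<tau>) (\<lambda>(u, v). h u v)"
  show thesis
  proof (rule that[of \<gamma>])
    show "sets \<gamma> = sets (\<pi> \<Otimes>\<^sub>M \<tau>)" by (simp add: \<gamma>_def)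
    show "\<forall>f\<in>borel_measurable \<pi>. (\<integral>\<^sup>+z. f (fst z) \<partial>\<gamma>) = (\<integral>\<^sup>+u. f u \<partial>\<pi>)"
    proof
      fix f :: "'a \<times> 'a \<Rightarrow> ennreal" assume [measurable]: "f \<in> borel_measurable \<pi>"
      have "(\<integral>\<^sup>+z. f (fst z) \<partial>\<gamma>) = (\<integral>\<^sup>+z. (case z of (u, v) \<Rightarrow> h u v * f u) \<partial>(\<pi> \<Otimes>\<^sub>M \<tau>))"
        unfolding \<gamma>_def by (subst nn_integral_density) (auto simp: split_beta' intro!: nn_integral_cong)
      also have "\<dots> = (\<integral>\<^sup>+u. (\<integral>\<^sup>+v. h u v * f u \<partial>\<tau>) \<partial>\<pi>)"
        by (subst \<tau>.nn_integral_fst[symmetric]) auto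
      also have "\<dots> = (\<integral>\<^sup>+u. (\<integral>\<^sup>+v. h u v \<partial>\<tau>) * f u \<partial>\<pi>)"
        by (intro nn_integral_cong nn_integral_multc) measurable
      also have "\<dots> = (\<integral>\<^sup>+u. f u \<partial>\<pi>)"
        using h1 by (intro nn_integral_cong_AE) auto
      finally show "(\<integral>\<^sup>+z. f (fst z) \<partial>\<gamma>) = (\<integral>\<^sup>+u. f u \<partial>\<pi>)" .
    qed
    show "\<forall>f\<in>borel_measurable \<tau>. (\<integral>\<^sup>+z. f (snd z) \<partial>\<gamma>) = (\<integral>\<^sup>+v. f v \<partial>\<tau>)"
    proof
      fix f :: "'a \<times> 'a \<Rightarrow> ennreal" assume [measurable]: "f \<in> borel_measurable \<tau>"
      have "(\<integral>\<^sup>+z. f (snd z) \<partial>\<gamma>) = (\<integral>\<^sup>+z. (case z of (u, v) \<Rightarrow> h u v * f v) \<partial>(\<pi> \<Otimes>\<^sub>M \<tau>))"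
        unfolding \<gamma>_def by (subst nn_integral_density) (auto simp: split_beta' intro!: nn_integral_cong)
      also have "\<dots> = (\<integral>\<^sup>+v. (\<integral>\<^sup>+u. h u v * f v \<partial>\<pi>) \<partial>\<tau>)"
        by (subst nn_integral_snd[symmetric]) auto
      also have "\<dots> = (\<integral>\<^sup>+v. (\<integral>\<^sup>+u. h u v \<partial>\<pi>) * f v \<partial>\<tau>)"
        by (intro nn_integral_cong nn_integral_multc) measurable
      also have "\<dots> = (\<integral>\<^sup>+v. f v \<partial>\<tau>)"
        using h2 by (intro nn_integral_cong_AE) auto
      finally show "(\<integral>\<^sup>+z. f (snd z) \<partial>\<gamma>) = (\<integral>\<^sup>+v. f v \<partial>\<tau>)" .
    qed
    show "AE z in \<gamma>. dist (snd (fst z)) (fst (snd z)) < e"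
      unfolding \<gamma>_def by (subst AE_density) (auto simp: h_def split_beta' k_dist)
  qed
qed

text \<open>Almost optimal couplings are glued up to a gap smaller than \<open>c\<close> and
  projected to the outer coordinates. Taking \<open>a\<close>, \<open>b\<close>, \<open>c\<close> as
  weights in \<open>powr_add3_convex\<close>, the three terms integrate to at most \<open>a\<close>,
  \<open>b\<close>, \<open>c\<close>, so the total cost is at most (a + b + c)^p.\<close>

lemma Wass_triangle:
  fixes \<mu> \<nu> \<sigma> :: "'a::polish_space measure"
  assumes p: "1 \<le> p" and P: "\<mu> \<in> Prob_p p" "\<nu> \<in> Prob_p p" "\<sigma> \<in> Prob_p p"
  shows "Wass p \<mu> \<sigma> \<le> Wass p \<mu> \<nu> + Wass p \<nu> \<sigma>"
proof (rule field_le_epsilon)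
  fix e :: real assume "0 < e"
  \<comment> \<open>The excess e/3 keeps the weights positive even when a distance is 0, and it
    provides couplings although the infimum is not known to be attained.\<close>
  define a b c where "a = Wass p \<mu> \<nu> + e / 3" and "b = Wass p \<nu> \<sigma> + e / 3" and "c = e / 3"
  have pos: "0 < a" "0 < b" "0 < c"
    using \<open>0 < e\<close> by (auto simp: a_def b_def c_def intro: add_nonneg_pos Wass_nonneg)
  have p0: "0 < p" using p by simp
  have \<nu>: "\<nu> \<in> Prob" using P by (simp add: Prob_p_def)
  obtain \<pi> where \<pi>: "\<pi> \<in> couplings \<mu> \<nu>"
    and c\<pi>: "(\<integral>\<^sup>+ z. ennreal (dist (fst z) (snd z) powr p) \<partial>\<pi>) < ennreal (a powr p)"
    using Wass_lessD[OF p0 P(1,2), of a] \<open>0 < e\<close> by (auto simp: a_def)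
  obtain \<tau> where \<tau>: "\<tau> \<in> couplings \<nu> \<sigma>"
    and c\<tau>: "(\<integral>\<^sup>+ z. ennreal (dist (fst z) (snd z) powr p) \<partial>\<tau>) < ennreal (b powr p)"
    using Wass_lessD[OF p0 P(2,3), of b] \<open>0 < e\<close> by (auto simp: b_def)
  obtain \<gamma> where \<gamma>: "sets \<gamma> = sets (\<pi> \<Otimes>\<^sub>M \<tau>)"
    "\<forall>f\<in>borel_measurable \<pi>. (\<integral>\<^sup>+z. f (fst z) \<partial>\<gamma>) = (\<integral>\<^sup>+u. f u \<partial>\<pi>)"
    "\<forall>f\<in>borel_measurable \<tau>. (\<integral>\<^sup>+z. f (snd z) \<partial>\<gamma>) = (\<integral>\<^sup>+v. f v \<partial>\<tau>)"
    "AE z in \<gamma>. dist (snd (fst z)) (fst (snd z)) < c"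
    using approximate_gluing[OF \<pi> \<tau> \<nu> pos(3)] .
  interpret \<pi>: prob_space \<pi> using couplingsD[OF \<pi>] by simp
  interpret \<tau>: prob_space \<tau> using couplingsD[OF \<tau>] by simp
  have s [measurable_cong]: "sets \<pi> = sets (borel \<Otimes>\<^sub>M borel)" "sets \<tau> = sets (borel \<Otimes>\<^sub>M borel)"
    by (rule sets_coupling[OF \<pi>] sets_coupling[OF \<tau>])+
  note [measurable_cong] = \<gamma>(1)
  have "emeasure \<gamma> (space \<gamma>) = 1"
    using \<gamma>(2)[rule_format, of "\<lambda>_. 1"] \<pi>.emeasure_space_1 by simp
  then interpret \<gamma>: prob_space \<gamma> by (rule prob_spaceI)
  define \<theta> where "\<theta> = distr \<gamma> (borel \<Otimes>\<^sub>M borel) (\<lambda>z. (fst (fst z), snd (snd z)))"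
  have "distr \<theta> borel fst = \<mu>"
  proof (rule measure_eqI)
    show sm: "sets (distr \<theta> borel fst) = sets \<mu>" using P by (simp add: Prob_p_def ProbD)
    fix A assume "A \<in> sets (distr \<theta> borel fst)"
    then have A [measurable]: "A \<in> sets borel" by simp
    have "emeasure (distr \<theta> borel fst) A = (\<integral>\<^sup>+x. indicator A x \<partial>distr \<theta> borel fst)" by simp
    also have "\<dots> = (\<integral>\<^sup>+x. indicator A x \<partial>distr \<gamma> borel (\<lambda>z. fst (fst z)))"
      unfolding \<theta>_def by (simp add: distr_distr comp_def)
    also have "(\<integral>\<^sup>+x. indicator A x \<partial>distr \<gamma> borel (\<lambda>z. fst (fst z))) = (\<integral>\<^sup>+z. indicator A (fst (fst z)) \<partial>\<gamma>)"
      by (intro nn_integral_distr) measurable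
    also have "\<dots> = (\<integral>\<^sup>+u. indicator A (fst u) \<partial>\<pi>)" by (intro \<gamma>(2)[rule_format]) measurable
    also have "\<dots> = (\<integral>\<^sup>+x. indicator A x \<partial>\<mu>)" by (intro nn_integral_coupling_fst[OF \<pi>]) measurable
    also have "\<dots> = emeasure \<mu> A" using A unfolding sm[simplified] by (rule nn_integral_indicator)
    finally show "emeasure (distr \<theta> borel fst) A = emeasure \<mu> A" .
  qed
  moreover have "distr \<theta> borel snd = \<sigma>"
  proof (rule measure_eqI)
    show sm: "sets (distr \<theta> borel snd) = sets \<sigma>" using P by (simp add: Prob_p_def ProbD)
    fix A assume "A \<in> sets (distr \<theta> borel snd)"
    then have A [measurable]: "A \<in> sets borel" by simp
    have "emeasure (distr \<theta> borel snd) A = (\<integral>\<^sup>+x. indicator A x \<partial>distr \<theta> borel snd)" by simp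
    also have "\<dots> = (\<integral>\<^sup>+x. indicator A x \<partial>distr \<gamma> borel (\<lambda>z. snd (snd z)))"
      unfolding \<theta>_def by (simp add: distr_distr comp_def)
    also have "(\<integral>\<^sup>+x. indicator A x \<partial>distr \<gamma> borel (\<lambda>z. snd (snd z))) = (\<integral>\<^sup>+z. indicator A (snd (snd z)) \<partial>\<gamma>)"
      by (intro nn_integral_distr) measurable
    also have "\<dots> = (\<integral>\<^sup>+u. indicator A (snd u) \<partial>\<tau>)" by (intro \<gamma>(3)[rule_format]) measurable
    also have "\<dots> = (\<integral>\<^sup>+x. indicator A x \<partial>\<sigma>)" by (intro nn_integral_coupling_snd[OF \<tau>]) measurable
    also have "\<dots> = emeasure \<sigma> A" using A unfolding sm[simplified] by (rule nn_integral_indicator)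
    finally show "emeasure (distr \<theta> borel snd) A = emeasure \<sigma> A" .
  qed
  moreover have "sets \<theta> = sets borel" unfolding \<theta>_def borel_prod by simp
  moreover have "prob_space \<theta>" unfolding \<theta>_def by (intro \<gamma>.prob_space_distr) measurable
  ultimately have \<theta>: "\<theta> \<in> couplings \<mu> \<sigma>" by (simp add: couplings_def)
  define S where "S = a + b + c"
  have "(\<integral>\<^sup>+ z. ennreal (dist (fst z) (snd z) powr p) \<partial>\<theta>) = (\<integral>\<^sup>+ z. ennreal (dist (fst (fst z)) (snd (snd z)) powr p) \<partial>\<gamma>)"
    unfolding \<theta>_def by (subst nn_integral_distr) auto
  also have "\<dots> \<le> (\<integral>\<^sup>+ z. ennreal (S powr (p - 1)) * (ennreal (a powr (1 - p)) * ennreal (dist (fst (fst z)) (snd (fst z)) powr p)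
      + ennreal (b powr (1 - p)) * ennreal (dist (fst (snd z)) (snd (snd z)) powr p) + ennreal c) \<partial>\<gamma>)"
    using \<gamma>(4)
  proof (intro nn_integral_mono_AE, eventually_elim)
    fix z :: "('a \<times> 'a) \<times> ('a \<times> 'a)"
    assume z: "dist (snd (fst z)) (fst (snd z)) < c"
    have "dist (fst (fst z)) (snd (snd z)) \<le> dist (fst (fst z)) (snd (fst z)) + dist (fst (snd z)) (snd (snd z)) + c"
      using z dist_triangle[of "fst (fst z)" "snd (snd z)" "snd (fst z)"]
        dist_triangle[of "snd (fst z)" "snd (snd z)" "fst (snd z)"] by simp
    then have "dist (fst (fst z)) (snd (snd z)) powr p \<le> (dist (fst (fst z)) (snd (fst z)) + dist (fst (snd z)) (snd (snd z)) + c) powr p"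
      using p by (intro powr_mono2) auto
    also have "\<dots> \<le> S powr (p - 1) * (a powr (1 - p) * dist (fst (fst z)) (snd (fst z)) powr p
      + b powr (1 - p) * dist (fst (snd z)) (snd (snd z)) powr p + c powr (1 - p) * c powr p)"
      unfolding S_def using pos p by (intro powr_add3_convex) auto
    also have "c powr (1 - p) * c powr p = c" using pos by (simp add: powr_add[symmetric])
    finally have "ennreal (dist (fst (fst z)) (snd (snd z)) powr p) \<le> ennreal (S powr (p - 1) * (a powr (1 - p) * dist (fst (fst z)) (snd (fst z)) powr p
      + b powr (1 - p) * dist (fst (snd z)) (snd (snd z)) powr p + c))" by (rule ennreal_leI)
    then show "ennreal (dist (fst (fst z)) (snd (snd z)) powr p) \<le> ennreal (S powr (p - 1)) * (ennreal (a powr (1 - p)) * ennreal (dist (fst (fst z)) (snd (fst z)) powr p)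
      + ennreal (b powr (1 - p)) * ennreal (dist (fst (snd z)) (snd (snd z)) powr p) + ennreal c)"
      using pos by (simp add: ennreal_mult)
  qed
  also have "\<dots> = ennreal (S powr (p - 1)) * (ennreal (a powr (1 - p)) * (\<integral>\<^sup>+ z. ennreal (dist (fst (fst z)) (snd (fst z)) powr p) \<partial>\<gamma>)
      + ennreal (b powr (1 - p)) * (\<integral>\<^sup>+ z. ennreal (dist (fst (snd z)) (snd (snd z)) powr p) \<partial>\<gamma>) + ennreal c)"
    by (simp add: nn_integral_cmult nn_integral_add \<gamma>.emeasure_space_1)
  also have "(\<integral>\<^sup>+ z. ennreal (dist (fst (fst z)) (snd (fst z)) powr p) \<partial>\<gamma>) = (\<integral>\<^sup>+ u. ennreal (dist (fst u) (snd u) powr p) \<partial>\<pi>)"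
    by (rule \<gamma>(2)[rule_format]) measurable
  also have "(\<integral>\<^sup>+ z. ennreal (dist (fst (snd z)) (snd (snd z)) powr p) \<partial>\<gamma>) = (\<integral>\<^sup>+ u. ennreal (dist (fst u) (snd u) powr p) \<partial>\<tau>)"
    by (rule \<gamma>(3)[rule_format]) measurable
  also have "ennreal (S powr (p - 1)) * (ennreal (a powr (1 - p)) * (\<integral>\<^sup>+ u. ennreal (dist (fst u) (snd u) powr p) \<partial>\<pi>)
      + ennreal (b powr (1 - p)) * (\<integral>\<^sup>+ u. ennreal (dist (fst u) (snd u) powr p) \<partial>\<tau>) + ennreal c)
    \<le> ennreal (S powr (p - 1)) * (ennreal (a powr (1 - p)) * ennreal (a powr p) + ennreal (b powr (1 - p)) * ennreal (b powr p) + ennreal c)"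
    using c\<pi> c\<tau> by (intro mult_left_mono add_mono order_refl) auto
  also have "\<dots> = ennreal (S powr (p - 1) * (a powr (1 - p) * a powr p + b powr (1 - p) * b powr p + c))"
    using pos by (simp add: ennreal_mult)
  also have "S powr (p - 1) * (a powr (1 - p) * a powr p + b powr (1 - p) * b powr p + c) = S powr p"
  proof -
    have "a powr (1 - p) * a powr p = a" "b powr (1 - p) * b powr p = b" using pos by (simp_all add: powr_add[symmetric])
    moreover have "S powr (p - 1) * S = S powr p" using pos by (simp add: S_def powr_diff)
    ultimately show ?thesis by (simp add: S_def)
  qed
  finally have "Wass p \<mu> \<sigma> \<le> S"
    using pos p0 by (intro Wass_le[OF _ \<theta>]) (auto simp: S_def)
  then show "Wass p \<mu> \<sigma> \<le> Wass p \<mu> \<nu> + Wass p \<nu> \<sigma> + e"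
    by (simp add: S_def a_def b_def c_def)
qed

section \<open>The metric derivative\<close>

lemma absolutely_integrable_on_Icc:
  fixes f :: "real \<Rightarrow> real"
  assumes "f absolutely_integrable_on UNIV"
  shows "f absolutely_integrable_on {a..b}" "f integrable_on {a..b}"
proof -
  show "f absolutely_integrable_on {a..b}"
    using assms by (rule set_integrable_subset) auto
  then show "f integrable_on {a..b}"
    by (rule set_lebesgue_integral_eq_integral(1))
qed

text \<open>In dimension one, the cubes with lower corner x are the intervals [x, x + h].\<close>

lemma Lebesgue_differentiation_right:
  fixes f :: "real \<Rightarrow> real"
  assumes "f absolutely_integrable_on UNIV"
  obtains N where "negligible N"
    "\<forall>x. x \<notin> N \<longrightarrow> ((\<lambda>y. integral {x..y} f / (y - x)) \<longlongrightarrow> f x) (at_right x)"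
proof -
  obtain N where N: "negligible N" "\<And>x e. \<lbrakk>x \<notin> N; 0 < e\<rbrakk> \<Longrightarrow>
      \<exists>d>0. \<forall>h. 0 < h \<and> h < d \<longrightarrow> norm (integral (cbox x (x + h *\<^sub>R One)) f /\<^sub>R h ^ DIM(real) - f x) < e"
    using integrable_ccontinuous_explicit[of f] absolutely_integrable_on_Icc(2)[OF assms]
    by (metis interval_cbox)
  have "((\<lambda>y. integral {x..y} f / (y - x)) \<longlongrightarrow> f x) (at_right x)" if "x \<notin> N" for x
  proof (rule tendstoI)
    fix e :: real assume "e > 0"
    then obtain d where d: "d > 0" "\<And>h. 0 < h \<Longrightarrow> h < d \<Longrightarrow> norm (integral (cbox x (x + h *\<^sub>R One)) f /\<^sub>R h ^ DIM(real) - f x) < e"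
      using N(2)[OF \<open>x \<notin> N\<close>] by blast
    show "\<forall>\<^sub>F y in at_right x. dist (integral {x..y} f / (y - x)) (f x) < e"
      unfolding eventually_at_right_field
    proof (intro exI[of _ "x + d"] conjI allI impI)
      fix y assume "x < y" "y < x + d"
      then show "dist (integral {x..y} f / (y - x)) (f x) < e"
        using d(2)[of "y - x"] by (simp add: dist_real_def divide_inverse mult.commute)
    qed (use \<open>d > 0\<close> in auto)
  qed
  then show thesis using that N(1) by blast
qed

text \<open>The left-hand limit is the right-hand limit for the reflected function at -x, so the
  reflection of its exceptional set has to be discarded as well.\<close>

lemma Lebesgue_differentiation:
  fixes f :: "real \<Rightarrow> real"
  assumes f: "f absolutely_integrable_on UNIV"
  obtains N where "negligible N"
    "\<forall>x. x \<notin> N \<longrightarrow> ((\<lambda>y. integral {min x y..max x y} f / \<bar>y - x\<bar>) \<longlongrightarrow> f x) (at x)"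
proof -
  obtain N where N: "negligible N" "\<forall>x. x \<notin> N \<longrightarrow> ((\<lambda>y. integral {x..y} f / (y - x)) \<longlongrightarrow> f x) (at_right x)"
    using Lebesgue_differentiation_right[OF f] .
  have f': "(\<lambda>x. f (- x)) absolutely_integrable_on UNIV"
    using f lebesgue_integrable_real_affine[of "f" "-1" 0] by (simp add: set_integrable_def)
  obtain M where M: "negligible M" "\<forall>x. x \<notin> M \<longrightarrow> ((\<lambda>y. integral {x..y} (\<lambda>x. f (- x)) / (y - x)) \<longlongrightarrow> f (- x)) (at_right x)"
    using Lebesgue_differentiation_right[OF f'] .
  have "negligible (uminus ` M)"
    by (rule negligible_locally_Lipschitz_image[OF _ M(1)])
      (use norm_minus_commute in \<open>auto intro!: exI[of _ "UNIV :: real set"] exI[of _ "1 :: real"]\<close>)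
  then have neg: "negligible (N \<union> uminus ` M)" using N(1) by simp
  have "((\<lambda>y. integral {min x y..max x y} f / \<bar>y - x\<bar>) \<longlongrightarrow> f x) (at x)" if x: "x \<notin> N \<union> uminus ` M" for x
  proof -
    have "((\<lambda>y. integral {min x y..max x y} f / \<bar>y - x\<bar>) \<longlongrightarrow> f x) (at_right x)"
    proof (rule Lim_transform_eventually)
      show "((\<lambda>y. integral {x..y} f / (y - x)) \<longlongrightarrow> f x) (at_right x)" using N x by blast
      show "\<forall>\<^sub>F y in at_right x. integral {x..y} f / (y - x) = integral {min x y..max x y} f / \<bar>y - x\<bar>"
        by (auto simp: eventually_at_right_field intro!: exI[of _ "x + 1"])
    qed
    moreover have "((\<lambda>y. integral {min x y..max x y} f / \<bar>y - x\<bar>) \<longlongrightarrow> f x) (at_left x)"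
    proof -
      have "- x \<notin> M" using x by force
      then have l: "((\<lambda>y. integral {- x..y} (\<lambda>x. f (- x)) / (y + x)) \<longlongrightarrow> f x) (at_right (- x))"
        using M(2)[rule_format, of "- x"] by simp
      have r: "integral {- x..y} (\<lambda>x. f (- x)) = integral {- y..x} f" for y
        using Henstock_Kurzweil_Integration.integral_reflect_real[of x "- y" f] by simp
      have "((\<lambda>y. integral {y..x} f / (x - y)) \<longlongrightarrow> f x) (at_left x)"
        using l unfolding r at_left_minus filterlim_filtermap by (simp add: add.commute)
      then show ?thesis
      proof (rule Lim_transform_eventually)
        show "\<forall>\<^sub>F y in at_left x. integral {y..x} f / (x - y) = integral {min x y..max x y} f / \<bar>y - x\<bar>"
          by (auto simp: eventually_at_left_field intro!: exI[of _ "x - 1"])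
      qed
    qed
    ultimately show ?thesis by (simp add: filterlim_at_split)
  qed
  then show thesis using that neg by blast
qed

section \<open>Functions whose increments are dominated by an integral\<close>

lemma nn_integral_eq_HK_integral:
  fixes m :: "real \<Rightarrow> real"
  assumes m: "m absolutely_integrable_on {a..b}" and "\<And>x. 0 \<le> m x"
  shows "(\<integral>\<^sup>+x. ennreal (m x) * indicator {a..b} x \<partial>lebesgue) = ennreal (integral {a..b} m)"
proof -
  have "(m has_integral integral {a..b} m) {a..b}"
    using set_lebesgue_integral_eq_integral(1)[OF m] by (rule integrable_integral)
  then have "((\<lambda>x. m x * indicator {a..b} x) has_integral integral {a..b} m) UNIV"
    unfolding has_integral_restrict_UNIV[of "{a..b}", symmetric] by (rule has_integral_eq[rotated]) auto
  then have "(\<integral>\<^sup>+x. ennreal (m x * indicator {a..b} x) \<partial>lebesgue) = ennreal (integral {a..b} m)"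
    using assms(2) by (subst (asm) has_integral_iff_nn_integral_lebesgue) auto
  then show ?thesis by (simp add: ennreal_mult' ennreal_indicator assms(2) flip: ennreal_indicator)
qed

text \<open>Serves the complement step of a Dynkin argument in which two finite measures are
  added.\<close>

lemma ennreal_diff_add_diff:
  fixes A B a b :: ennreal
  assumes "a \<le> A" "b \<le> B" "A < \<infinity>" "B < \<infinity>"
  shows "(A - a) + (B - b) = (A + B) - (a + b)"
  using assms
  by (cases A; cases B; cases a; cases b)
    (auto simp: ennreal_minus top_unique simp flip: ennreal_plus)

text \<open>Radon--Nikodym applied to the Stieltjes measures of \<open>M + f\<close> and \<open>M - f\<close>, where \<open>M\<close> is the
  primitive of \<open>m\<close>: the two measures add up to the one with density \<open>2m\<close>.\<close>
lemma dominated_increments_imp_integral: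
  fixes f m :: "real \<Rightarrow> real"
  assumes "a \<le> b" and m: "m absolutely_integrable_on {a..b}" and m0: "\<And>x. 0 \<le> m x"
    and dom: "\<And>s t. a \<le> s \<Longrightarrow> s \<le> t \<Longrightarrow> t \<le> b \<Longrightarrow> \<bar>f t - f s\<bar> \<le> integral {s..t} m"
  obtains h where "h absolutely_integrable_on UNIV" "\<forall>s t. a \<le> s \<longrightarrow> s \<le> t \<longrightarrow> t \<le> b \<longrightarrow> f t - f s = integral {s..t} h"
proof -
  have mi: "m integrable_on {s..t}" if "a \<le> s" "t \<le> b" for s t
  proof -
    have "m integrable_on {a..b}" using m by (rule set_lebesgue_integral_eq_integral(1))
    then show ?thesis by (rule integrable_on_subinterval) (use that in auto)
  qed
  have ma: "m absolutely_integrable_on {s..t}" if "a \<le> s" "t \<le> b" for s t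
    using m by (rule set_integrable_subset) (use that in auto)
  define M where "M x = integral {a..x} m" for x
  have Mdiff: "M t - M s = integral {s..t} m" if "a \<le> s" "s \<le> t" "t \<le> b" for s t
    using Henstock_Kurzweil_Integration.integral_combine[of a s t m] mi[of a t] that by (simp add: M_def)
  \<comment> \<open>Clamping to [a, b] extends \<open>M\<close> and \<open>f\<close> by constants to
    the whole line, so that their Stieltjes measures put no mass outside the interval.\<close>
  define c where "c x = max a (min b x)" for x
  have c: "a \<le> c x" "c x \<le> b" for x using \<open>a \<le> b\<close> by (auto simp: c_def)
  have cmono: "c x \<le> c y" if "x \<le> y" for x y using that by (auto simp: c_def)
  have ccont: "continuous_on UNIV c" unfolding c_def by (intro continuous_intros)
  have Mcont: "continuous_on {a..b} M" unfolding M_def by (intro indefinite_integral_continuous_1 mi) auto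
  have fdom: "\<bar>f t - f s\<bar> \<le> \<bar>M t - M s\<bar>" if "s \<in> {a..b}" "t \<in> {a..b}" for s t
    using that dom[of s t] dom[of t s] Mdiff[of s t] Mdiff[of t s] by (cases "s \<le> t") auto
  have fcont: "continuous_on {a..b} f"
    unfolding continuous_on_iff
  proof (intro ballI allI impI)
    fix x e :: real assume "x \<in> {a..b}" "0 < e"
    then obtain d where "d > 0" "\<forall>x'\<in>{a..b}. dist x' x < d \<longrightarrow> dist (M x') (M x) < e"
      using Mcont unfolding continuous_on_iff by blast
    then show "\<exists>d>0. \<forall>x'\<in>{a..b}. dist x' x < d \<longrightarrow> dist (f x') (f x) < e"
      using fdom[OF \<open>x \<in> {a..b}\<close>] unfolding dist_real_def by (meson le_less_trans)
  qed
  define F H where "F x = M (c x) + f (c x)" and "H x = M (c x) - f (c x)" for x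
  have "continuous_on UNIV (\<lambda>x. M (c x))" "continuous_on UNIV (\<lambda>x. f (c x))"
    using c by (auto intro!: continuous_on_compose2[OF Mcont ccont] continuous_on_compose2[OF fcont ccont])
  then have "continuous_on UNIV F" "continuous_on UNIV H" unfolding F_def H_def by (auto intro!: continuous_intros)
  then have cont: "continuous (at_right x) F" "continuous (at_right x) H" for x
    by (auto simp: continuous_on_eq_continuous_at intro: continuous_at_imp_continuous_within)
  have mono: "F x \<le> F y" "H x \<le> H y" if "x \<le> y" for x y
    using dom[of "c x" "c y"] Mdiff[of "c x" "c y"] c cmono[OF that] by (auto simp: F_def H_def)
  \<comment> \<open>The factor 2 arises because F + H equals 2 M after clamping: \<open>f\<close>
    cancels.\<close>
  define g where "g x = ennreal (2 * m x) * indicator {a..b} x" for x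
  have m_meas [measurable]: "(\<lambda>x. m x * indicator {a..b} x) \<in> borel_measurable lebesgue"
    using m by (auto simp: set_integrable_def mult.commute)
  have g_eq: "g x = ennreal (2 * (m x * indicator {a..b} x))" for x
    by (auto simp: g_def indicator_def)
  have g_meas [measurable]: "g \<in> borel_measurable lebesgue"
    unfolding g_eq by measurable
  have g_int: "(\<integral>\<^sup>+z. g z * indicator {x<..y} z \<partial>lebesgue) = ennreal (2 * (M (c y) - M (c x)))" if "x \<le> y" for x y
  proof -
    \<comment> \<open>Inside [a, b], the half-open interval from x to y and the closed interval from
      \<open>c x\<close> to \<open>c y\<close> differ at most in the point
      \<open>c x\<close>.\<close>
    have "(\<integral>\<^sup>+z. g z * indicator {x<..y} z \<partial>lebesgue) = (\<integral>\<^sup>+z. 2 * (ennreal (m z) * indicator {c x..c y} z) \<partial>lebesgue)"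
    proof (intro nn_integral_cong_AE AE_I[of _ _ "{c x}"])
      show "{z \<in> space lebesgue. g z * indicator {x<..y} z \<noteq> 2 * (ennreal (m z) * indicator {c x..c y} z)} \<subseteq> {c x}"
        using that m0 by (auto simp: g_def c_def indicator_def ennreal_mult max_def min_def split: if_splits)
    qed auto
    also have "\<dots> = 2 * (\<integral>\<^sup>+z. ennreal (m z) * indicator {c x..c y} z \<partial>lebesgue)"
    proof (intro nn_integral_cmult)
      have "(\<lambda>z. m z * indicator {c x..c y} z) \<in> borel_measurable lebesgue"
        using ma[of "c x" "c y"] c by (auto simp: set_integrable_def mult.commute)
      then have "(\<lambda>z. ennreal (m z * indicator {c x..c y} z)) \<in> borel_measurable lebesgue" by measurable
      also have "(\<lambda>z. ennreal (m z * indicator {c x..c y} z)) = (\<lambda>z. ennreal (m z) * indicator {c x..c y} z)"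
        by (auto simp: indicator_def)
      finally show "(\<lambda>z. ennreal (m z) * indicator {c x..c y} z) \<in> borel_measurable lebesgue" .
    qed
    also have "\<dots> = 2 * ennreal (M (c y) - M (c x))"
      using nn_integral_eq_HK_integral[OF ma m0, of "c x" "c y"] Mdiff[of "c x" "c y"] c cmono[OF that] by simp
    also have "\<dots> = ennreal (2 * (M (c y) - M (c x)))"
      using dom[of "c x" "c y"] Mdiff[of "c x" "c y"] c cmono[OF that] by (simp add: ennreal_mult)
    finally show ?thesis .
  qed
  define P where "P A \<longleftrightarrow> emeasure (interval_measure F) A + emeasure (interval_measure H) A = emeasure (density lebesgue g) A" for A
  have P_Ioc: "P {x<..y}" for x y
  proof (cases "x \<le> y")
    case True
    then show ?thesis
      using mono[OF True] cont mono
      by (simp add: P_def emeasure_interval_measure_Ioc emeasure_density g_int[OF True] F_def H_def flip: ennreal_plus)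
  qed (simp add: P_def)
  \<comment> \<open>The whole line is not one of the generating intervals, but its measure is needed
    to pass to complements.\<close>
  have P_UNIV: "P UNIV"
  proof -
    have U: "(\<Union>n. {- real n<..real n}) = (UNIV :: real set)"
    proof (intro set_eqI iffI UNIV_I)
      fix x :: real
      obtain n where "\<bar>x\<bar> < real n" using reals_Archimedean2 by blast
      then show "x \<in> (\<Union>n. {- real n<..real n})" by (intro UN_I[of n]) auto
    qed
    have inc: "incseq (\<lambda>n. {- real n<..real n})" by (auto simp: incseq_def)
    have lim: "(\<lambda>n. emeasure N {- real n<..real n}) \<longlonglongrightarrow> emeasure N UNIV"
      if "sets N = sets borel \<or> sets N = sets lebesgue" for N
    proof -
      have "range (\<lambda>n. {- real n<..real n}) \<subseteq> sets N" using that by force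
      from Lim_emeasure_incseq[OF this inc] show ?thesis unfolding U .
    qed
    have "(\<lambda>n. emeasure (interval_measure F) {- real n<..real n} + emeasure (interval_measure H) {- real n<..real n})
       \<longlonglongrightarrow> emeasure (interval_measure F) UNIV + emeasure (interval_measure H) UNIV"
      by (intro tendsto_add lim) auto
    moreover have "(\<lambda>n. emeasure (density lebesgue g) {- real n<..real n}) \<longlonglongrightarrow> emeasure (density lebesgue g) UNIV"
      by (intro lim) auto
    ultimately show ?thesis
      using P_Ioc unfolding P_def by (simp add: LIMSEQ_unique)
  qed
  have fin_g: "emeasure (density lebesgue g) UNIV < \<infinity>"
  proof -
    have "emeasure (density lebesgue g) UNIV = (\<integral>\<^sup>+x. ennreal (2 * (m x * indicator {a..b} x)) \<partial>lebesgue)"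
      by (simp add: emeasure_density g_eq)
    also have "\<dots> = (\<integral>\<^sup>+x. 2 * (ennreal (m x) * indicator {a..b} x) \<partial>lebesgue)"
      by (intro nn_integral_cong) (auto simp: indicator_def ennreal_mult m0)
    also have "\<dots> = 2 * (\<integral>\<^sup>+x. (ennreal (m x) * indicator {a..b} x) \<partial>lebesgue)"
    proof (intro nn_integral_cmult)
      have "(\<lambda>z. ennreal (m z * indicator {a..b} z)) \<in> borel_measurable lebesgue" by measurable
      also have "(\<lambda>z. ennreal (m z * indicator {a..b} z)) = (\<lambda>z. ennreal (m z) * indicator {a..b} z)"
        by (auto simp: indicator_def)
      finally show "(\<lambda>z. ennreal (m z) * indicator {a..b} z) \<in> borel_measurable lebesgue" .
    qed
    also have "\<dots> < \<infinity>" using nn_integral_eq_HK_integral[OF m m0] by (simp add: ennreal_mult_less_top)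
    finally show ?thesis .
  qed
  have fin_FH: "emeasure (interval_measure F) UNIV < \<infinity>" "emeasure (interval_measure H) UNIV < \<infinity>"
    using P_UNIV fin_g unfolding P_def by (auto simp: less_top[symmetric])
  have P_borel: "P A" if "A \<in> sets borel" for A
  proof -
    have "Int_stable (range (\<lambda>(x, y). {x<..y::real}))"
      by (auto simp: Int_stable_def)
    moreover have "range (\<lambda>(x, y). {x<..y::real}) \<subseteq> Pow UNIV" by simp
    moreover have "A \<in> sigma_sets UNIV (range (\<lambda>(x, y). {x<..y::real}))"
      using that unfolding borel_sigma_sets_Ioc by simp
    ultimately show ?thesis
    proof (induction rule: sigma_sets_induct_disjoint)
      case (basic A) then show ?case using P_Ioc by auto
    next
      case empty then show ?case by (simp add: P_def)
    next
      case (compl A)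
      then have A: "A \<in> sets borel" unfolding borel_sigma_sets_Ioc by simp
      have "emeasure N (UNIV - A) = emeasure N UNIV - emeasure N A" "emeasure N A \<le> emeasure N UNIV"
        if "sets N = sets borel \<or> sets N = sets lebesgue" "emeasure N UNIV < \<infinity>" for N
      proof -
        have "space N = UNIV" "A \<in> sets N"
          using that(1) A sets_eq_imp_space_eq[of N borel] sets_eq_imp_space_eq[of N lebesgue] by auto
        then show "emeasure N A \<le> emeasure N UNIV" by (metis emeasure_space)
        then show "emeasure N (UNIV - A) = emeasure N UNIV - emeasure N A"
          using emeasure_compl[of A N] that \<open>space N = UNIV\<close> \<open>A \<in> sets N\<close> by (simp add: less_top)
      qed
      note * = this
      show ?case
        using compl(2) P_UNIV *[of "interval_measure F"] *[of "interval_measure H"] *[of "density lebesgue g"] fin_FH fin_g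
        unfolding P_def by (simp add: ennreal_diff_add_diff)
    next
      case (union A)
      then have A: "range A \<subseteq> sets borel" unfolding borel_sigma_sets_Ioc by auto
      have "range A \<subseteq> sets lebesgue" using A by auto
      then have "(\<Sum>n. emeasure (interval_measure F) (A n)) = emeasure (interval_measure F) (\<Union>n. A n)"
           "(\<Sum>n. emeasure (interval_measure H) (A n)) = emeasure (interval_measure H) (\<Union>n. A n)"
           "(\<Sum>n. emeasure (density lebesgue g) (A n)) = emeasure (density lebesgue g) (\<Union>n. A n)"
        using A union(1) by (auto intro!: suminf_emeasure)
      moreover have "(\<Sum>n. emeasure (interval_measure F) (A n)) + (\<Sum>n. emeasure (interval_measure H) (A n))
          = (\<Sum>n. emeasure (density lebesgue g) (A n))"
        using union(3) by (simp add: suminf_add P_def)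
      ultimately show ?case unfolding P_def by simp
    qed
  qed
  \<comment> \<open>A set that is null for Lebesgue measure is null for the sum of the two Stieltjes
    measures, hence for each of them.\<close>
  have "absolutely_continuous lborel (interval_measure F)"
    unfolding absolutely_continuous_def
  proof
    fix A :: "real set" assume A: "A \<in> null_sets lborel"
    then have "A \<in> null_sets lebesgue" "A \<in> sets borel" by (auto intro: null_sets_completionI)
    moreover have "absolutely_continuous lebesgue (density lebesgue g)"
      by (intro absolutely_continuousI_density) measurable
    ultimately have "emeasure (density lebesgue g) A = 0"
      by (auto simp: absolutely_continuous_def)
    then have "emeasure (interval_measure F) A = 0"
      using P_borel[OF \<open>A \<in> sets borel\<close>] unfolding P_def by simp
    then show "A \<in> null_sets (interval_measure F)" using \<open>A \<in> sets borel\<close> by auto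
  qed
  then obtain \<psi> where [measurable]: "\<psi> \<in> borel_measurable lborel" and \<psi>: "density lborel \<psi> = interval_measure F"
    using sigma_finite_measure.Radon_Nikodym[OF sigma_finite_lborel, of "interval_measure F"] by auto
  define r where "r x = enn2real (\<psi> x)" for x
  have [measurable]: "r \<in> borel_measurable borel" unfolding r_def by measurable
  have "(\<integral>\<^sup>+x. \<psi> x \<partial>lborel) = emeasure (interval_measure F) UNIV"
    unfolding \<psi>[symmetric] by (simp add: emeasure_density)
  then have "AE x in lborel. \<psi> x \<noteq> \<infinity>"
    using fin_FH by (intro nn_integral_PInf_AE) auto
  then have AEr: "AE x in lborel. \<psi> x = ennreal (r x)"
    by eventually_elim (auto simp: r_def less_top)
  have r_int: "(r has_integral (F y - F x)) {x..y}" if "x \<le> y" for x y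
  proof -
    have "(\<integral>\<^sup>+z. ennreal (r z * indicator {x<..y} z) \<partial>lborel) = (\<integral>\<^sup>+z. \<psi> z * indicator {x<..y} z \<partial>lborel)"
      using AEr by (intro nn_integral_cong_AE) (auto simp: indicator_def elim!: eventually_mono)
    also have "\<dots> = emeasure (interval_measure F) {x<..y}"
      unfolding \<psi>[symmetric] by (simp add: emeasure_density)
    also have "\<dots> = ennreal (F y - F x)"
      using that mono cont by (simp add: emeasure_interval_measure_Ioc)
    finally have "((\<lambda>z. r z * indicator {x<..y} z) has_integral (F y - F x)) UNIV"
      using mono[OF that] by (intro nn_integral_has_integral) (auto simp: r_def)
    then have "(r has_integral (F y - F x)) {x<..y}"
      unfolding has_integral_restrict_UNIV[of "{x<..y}", symmetric] by (rule has_integral_eq[rotated]) auto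
    then show ?thesis
      by (rule has_integral_spike_set_eq[THEN iffD1, rotated -1]) (auto intro: negligible_subset[of "{x}"])
  qed
  have r_abs: "r absolutely_integrable_on {a..b}"
    using r_int[OF \<open>a \<le> b\<close>] by (intro nonnegative_absolutely_integrable_1) (auto simp: integrable_on_def r_def)
  \<comment> \<open>\<open>r\<close> is a density for F = M + f and \<open>m\<close> one for
    \<open>M\<close>, so the difference is a density for \<open>f\<close> on [a, b].\<close>
  define h where "h x = indicator {a..b} x * (r x - m x)" for x
  have "(\<lambda>x. r x - m x) absolutely_integrable_on {a..b}" using r_abs m by (rule set_integral_diff)
  then have "h absolutely_integrable_on UNIV" by (simp add: set_integrable_def h_def)
  moreover have "f t - f s = integral {s..t} h" if "a \<le> s" "s \<le> t" "t \<le> b" for s t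
  proof -
    have "integral {s..t} h = integral {s..t} (\<lambda>x. r x - m x)"
      using that by (intro Henstock_Kurzweil_Integration.integral_cong) (auto simp: h_def)
    also have "\<dots> = integral {s..t} r - integral {s..t} m"
      using r_int[OF that(2)] mi that by (intro Henstock_Kurzweil_Integration.integral_diff) (auto simp: integrable_on_def)
    also have "\<dots> = F t - F s - (M t - M s)"
      using r_int[OF that(2)] Mdiff that by (simp add: integral_unique)
    also have "\<dots> = f t - f s"
      using that by (simp add: F_def c_def)
    finally show ?thesis by simp
  qed
  ultimately show thesis using that by blast
qed

section \<open>Existence of the metric derivative\<close>

lemma HK_integral_mono_AE:
  fixes f g :: "real \<Rightarrow> real"
  assumes f: "f absolutely_integrable_on UNIV" and g: "g absolutely_integrable_on UNIV"
    and le: "AE x in lebesgue. x \<in> {s..t} \<longrightarrow> f x \<le> g x"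
  shows "integral {s..t} f \<le> integral {s..t} g"
proof -
  have fg: "f absolutely_integrable_on {s..t}" "g absolutely_integrable_on {s..t}"
    using absolutely_integrable_on_Icc f g by blast+
  have "(LINT x:{s..t}|lebesgue. f x) \<le> (LINT x:{s..t}|lebesgue. g x)"
    unfolding set_lebesgue_integral_def
    using fg le by (intro integral_mono_AE) (auto simp: set_integrable_def indicator_def elim!: eventually_mono)
  then show ?thesis
    using fg by (simp add: set_lebesgue_integral_eq_integral(2))
qed

lemma AE_lebesgue_negligible: "negligible N \<Longrightarrow> AE x in lebesgue. x \<notin> N"
  by (simp add: negligible_iff_null_sets AE_not_in)

text \<open>The density is the supremum, over a countable dense set of base points \<open>q\<close>, of the
  absolute derivatives of the real functions \<open>t \<mapsto> w q t\<close>.\<close>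
lemma metric_derivative_exists:
  fixes w :: "real \<Rightarrow> real \<Rightarrow> real" and m :: "real \<Rightarrow> real"
  assumes m: "m absolutely_integrable_on {a..b}"
    and refl: "\<And>t. t \<in> {a..b} \<Longrightarrow> w t t = 0"
    and nonneg: "\<And>s t. 0 \<le> w s t"
    and sym: "\<And>s t. w s t = w t s"
    and tri: "\<And>r s t. r \<in> {a..b} \<Longrightarrow> s \<in> {a..b} \<Longrightarrow> t \<in> {a..b} \<Longrightarrow> w r t \<le> w r s + w s t"
    and dom: "\<And>s t. a \<le> s \<Longrightarrow> s < t \<Longrightarrow> t \<le> b \<Longrightarrow> w s t \<le> integral {s..t} m"
  obtains D where "D absolutely_integrable_on UNIV" "\<forall>x. 0 \<le> D x"
    "\<forall>s t. a \<le> s \<longrightarrow> s \<le> t \<longrightarrow> t \<le> b \<longrightarrow> w s t \<le> integral {s..t} D"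
    "AE t in lebesgue. t \<in> {a<..<b} \<longrightarrow> ((\<lambda>s. w t s / \<bar>t - s\<bar>) \<longlongrightarrow> D t) (at t)"
proof -
  define n where "n x = \<bar>indicator {a..b} x * m x\<bar>" for x
  have n: "n absolutely_integrable_on UNIV"
    using m integrable_abs[of lebesgue "\<lambda>x. indicator {a..b} x * m x"] by (simp add: set_integrable_def n_def)
  have n0: "0 \<le> n x" for x by (simp add: n_def)
  have domn: "w s t \<le> integral {s..t} n" if "a \<le> s" "s \<le> t" "t \<le> b" for s t
  proof (cases "s = t")
    case True
    then show ?thesis using that refl by simp
  next
    case False
    have "m absolutely_integrable_on {s..t}" using m by (rule set_integrable_subset) (use that in auto)
    then have "m integrable_on {s..t}" by (rule set_lebesgue_integral_eq_integral(1))
    then have "integral {s..t} m \<le> integral {s..t} n"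
      using that absolutely_integrable_on_Icc(2)[OF n]
      by (intro integral_le) (auto simp: n_def)
    then show ?thesis using dom[of s t] that False by simp
  qed
  have lip: "\<bar>w q t - w q s\<bar> \<le> w s t" if "q \<in> {a..b}" "s \<in> {a..b}" "t \<in> {a..b}" for q s t
    using tri[of q s t] tri[of q t s] sym[of s t] that by auto
  have "\<forall>q\<in>{a..b}. \<exists>h. h absolutely_integrable_on UNIV \<and> (\<forall>s t. a \<le> s \<longrightarrow> s \<le> t \<longrightarrow> t \<le> b \<longrightarrow> w q t - w q s = integral {s..t} h)"
  proof
    fix q assume q: "q \<in> {a..b}"
    have inc: "\<bar>w q t - w q s\<bar> \<le> integral {s..t} n" if "a \<le> s" "s \<le> t" "t \<le> b" for s t
      using lip[OF q, of s t] domn[OF that] that by simp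
    have "a \<le> b" using q by simp
    obtain h where "h absolutely_integrable_on UNIV" "\<forall>s t. a \<le> s \<longrightarrow> s \<le> t \<longrightarrow> t \<le> b \<longrightarrow> w q t - w q s = integral {s..t} h"
      using dominated_increments_imp_integral[OF \<open>a \<le> b\<close> absolutely_integrable_on_Icc(1)[OF n] n0 inc] by blast
    then show "\<exists>h. h absolutely_integrable_on UNIV \<and> (\<forall>s t. a \<le> s \<longrightarrow> s \<le> t \<longrightarrow> t \<le> b \<longrightarrow> w q t - w q s = integral {s..t} h)"
      by blast
  qed
  from bchoice[OF this] obtain h where *: "\<forall>q\<in>{a..b}. h q absolutely_integrable_on UNIV \<and>
      (\<forall>s t. a \<le> s \<longrightarrow> s \<le> t \<longrightarrow> t \<le> b \<longrightarrow> w q t - w q s = integral {s..t} (h q))" ..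
  then have h: "h q absolutely_integrable_on UNIV" if "q \<in> {a..b}" for q
    using that by blast
  have h_eq: "w q t - w q s = integral {s..t} (h q)" if "q \<in> {a..b}" "a \<le> s" "s \<le> t" "t \<le> b" for q s t
    using * that by blast
  \<comment> \<open>With countably many base points, the exceptional null sets of the functions
    \<open>h q\<close> merge into a single one.\<close>
  define Q where "Q = \<rat> \<inter> {a..b}"
  have Q: "countable Q" "Q \<subseteq> {a..b}" unfolding Q_def using countable_rat by auto
  define ratio where "ratio f x y = integral {min x y..max x y} f / \<bar>y - x\<bar>" for f :: "real \<Rightarrow> real" and x y :: real
  have AE_ratio: "AE x in lebesgue. (ratio f x \<longlongrightarrow> f x) (at x)" if f: "f absolutely_integrable_on UNIV" for f
  proof -
    obtain N where N: "negligible N" "\<forall>x. x \<notin> N \<longrightarrow> ((\<lambda>y. integral {min x y..max x y} f / \<bar>y - x\<bar>) \<longlongrightarrow> f x) (at x)"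
      using Lebesgue_differentiation[OF f] .
    from AE_lebesgue_negligible[OF N(1)] show ?thesis
      unfolding ratio_def by eventually_elim (use N(2) in blast)
  qed
  have near: "\<forall>\<^sub>F y in at x. y \<in> {a<..<b} - {x}" if "x \<in> {a<..<b}" for x
    using that by (intro eventually_at_in_open) auto
  have ratio_h: "\<bar>ratio (h q) x y\<bar> = \<bar>w q y - w q x\<bar> / \<bar>y - x\<bar>" if "q \<in> {a..b}" "x \<in> {a<..<b}" "y \<in> {a<..<b}" for q x y
    using h_eq[OF that(1), of x y] h_eq[OF that(1), of y x] that by (cases "x \<le> y") (auto simp: ratio_def abs_minus_commute)
  have w_ratio_n: "w x y / \<bar>y - x\<bar> \<le> ratio n x y" if "x \<in> {a<..<b}" "y \<in> {a<..<b}" for x y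
    using domn[of x y] domn[of y x] sym[of x y] that by (cases "x \<le> y") (auto simp: ratio_def intro!: divide_right_mono)
  have AE_h_ratio: "AE x in lebesgue. \<forall>q\<in>Q. (ratio (h q) x \<longlongrightarrow> h q x) (at x)"
    using Q h AE_ratio by (subst AE_ball_countable) auto
  \<comment> \<open>Comparing difference quotients bounds all \<open>h q\<close> by the same
    integrable function, which makes their supremum finite and integrable.\<close>
  have AE_h_le: "AE x in lebesgue. x \<in> {a<..<b} \<longrightarrow> (\<forall>q\<in>Q. \<bar>h q x\<bar> \<le> n x)"
    using AE_h_ratio AE_ratio[OF n]
  proof eventually_elim
    case (elim x)
    show ?case
    proof (intro impI ballI)
      fix q assume x: "x \<in> {a<..<b}" and q: "q \<in> Q"
      show "\<bar>h q x\<bar> \<le> n x"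
      proof (rule tendsto_le[OF _ elim(2) tendsto_rabs])
        show "(ratio (h q) x \<longlongrightarrow> h q x) (at x)" using elim(1) q by blast
        show "\<forall>\<^sub>F y in at x. \<bar>ratio (h q) x y\<bar> \<le> ratio n x y"
          using near[OF x]
        proof eventually_elim
          case (elim y)
          have qi: "q \<in> {a..b}" using q Q by auto
          have "\<bar>ratio (h q) x y\<bar> = \<bar>w q y - w q x\<bar> / \<bar>y - x\<bar>" using ratio_h[OF qi x] elim by simp
          also have "\<dots> \<le> w x y / \<bar>y - x\<bar>"
            using lip[OF qi, of x y] x elim by (intro divide_right_mono) auto
          also have "\<dots> \<le> ratio n x y" using w_ratio_n x elim by simp
          finally show ?case .
        qed
      qed simp
    qed
  qed
  \<comment> \<open>The supremum is formed in \<open>ennreal\<close>, where it always exists and is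
    measurable. \<open>D\<close> then keeps only the open interval, inside which nearby times on
    both sides remain in [a, b].\<close>
  define D0 where "D0 x = (SUP q\<in>Q. ennreal \<bar>h q x\<bar>)" for x
  define D where "D x = indicator {a<..<b} x * enn2real (D0 x)" for x
  have D0: "0 \<le> D x" for x by (simp add: D_def)
  have h_meas: "h q \<in> borel_measurable lebesgue" if "q \<in> Q" for q
    using h[of q] Q that by (auto simp: set_integrable_def)
  have D0_meas: "D0 \<in> borel_measurable lebesgue"
    unfolding D0_def using Q h_meas by (intro borel_measurable_SUP) auto
  have D_meas: "D \<in> borel_measurable lebesgue"
    unfolding D_def using D0_meas by (intro borel_measurable_times borel_measurable_indicator measurable_compose[OF D0_meas]) auto
  have AE_D0: "AE x in lebesgue. x \<in> {a<..<b} \<longrightarrow> D0 x = ennreal (D x) \<and> D x \<le> n x"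
    using AE_h_le
  proof eventually_elim
    case (elim x)
    show ?case
    proof
      assume x: "x \<in> {a<..<b}"
      have "D0 x \<le> ennreal (n x)"
        unfolding D0_def using elim x by (intro SUP_least ennreal_leI) auto
      then show "D0 x = ennreal (D x) \<and> D x \<le> n x"
        using x n0[of x] by (cases "D0 x") (auto simp: D_def top_unique)
    qed
  qed
  have D: "D absolutely_integrable_on UNIV"
  proof -
    have "integrable lebesgue D"
    proof (rule Bochner_Integration.integrable_bound)
      show "integrable lebesgue n" using n by (simp add: set_integrable_def)
      show "AE x in lebesgue. norm (D x) \<le> norm (n x)"
        using AE_D0 by eventually_elim (auto simp: D_def n0 indicator_def)
    qed (rule D_meas)
    then show ?thesis by (simp add: set_integrable_def)
  qed
  have AE_h_D: "AE x in lebesgue. x \<in> {a<..<b} \<longrightarrow> (\<forall>q\<in>Q. \<bar>h q x\<bar> \<le> D x)"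
    using AE_D0
  proof eventually_elim
    case (elim x)
    show ?case
    proof (intro impI ballI)
      fix q assume "x \<in> {a<..<b}" "q \<in> Q"
      then have "ennreal \<bar>h q x\<bar> \<le> ennreal (D x)"
        using elim unfolding D0_def by (metis SUP_upper)
      then show "\<bar>h q x\<bar> \<le> D x" using D0 by simp
    qed
  qed
  \<comment> \<open>Since \<open>w q q\<close> is 0, this distance is itself an increment of the
    function with base point \<open>q\<close>.\<close>
  have wD_Q: "w q t \<le> integral {q..t} D" if "q \<in> Q" "q \<le> t" "t \<le> b" for q t
  proof -
    have q: "q \<in> {a..b}" using Q that by auto
    have "w q t = integral {q..t} (h q)" using h_eq[OF q, of q t] refl[OF q] that q by simp
    also have "\<dots> \<le> integral {q..t} D"
    proof (rule HK_integral_mono_AE[OF h[OF q] D])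
      have "AE x in lebesgue. x \<notin> {a, b}" by (intro AE_lebesgue_negligible) simp
      then show "AE x in lebesgue. x \<in> {q..t} \<longrightarrow> h q x \<le> D x"
        using AE_h_D
      proof eventually_elim
        case (elim x)
        then show ?case using that q by force
      qed
    qed
    finally show ?thesis .
  qed
  \<comment> \<open>A general \<open>s\<close> is approached from the right by rational
    \<open>q\<close>; the cost \<open>w s q\<close> vanishes by continuity of the integral of
    \<open>n\<close>.\<close>
  have wD: "w s t \<le> integral {s..t} D" if "a \<le> s" "s \<le> t" "t \<le> b" for s t
  proof (cases "s = t")
    case True
    then show ?thesis using that refl by simp
  next
    case False
    then have "s < t" using that by simp
    show ?thesis
    proof (rule field_le_epsilon)
      fix e :: real assume "0 < e"
      have "continuous_on {s..t} (\<lambda>x. integral {s..x} n)"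
        by (intro indefinite_integral_continuous_1 absolutely_integrable_on_Icc(2)[OF n])
      then obtain d where d: "d > 0" "\<forall>x\<in>{s..t}. dist x s < d \<longrightarrow> dist (integral {s..x} n) (integral {s..s} n) < e"
        using \<open>0 < e\<close> \<open>s < t\<close> unfolding continuous_on_iff by (metis atLeastAtMost_iff order_refl less_imp_le)
      obtain q where q: "q \<in> \<rat>" "s < q" "q < min t (s + d)"
        using Rats_dense_in_real[of s "min t (s + d)"] \<open>s < t\<close> d(1) by auto
      have "q \<in> Q" using q that by (simp add: Q_def)
      have "w s t \<le> w s q + w q t" using that q by (intro tri) auto
      also have "w s q \<le> integral {s..q} n" using that q by (intro domn) auto
      also have "\<dots> < e" using d(2)[rule_format, of q] q by (auto simp: dist_real_def)
      also have "w q t \<le> integral {q..t} D" using \<open>q \<in> Q\<close> q that by (intro wD_Q) auto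
      also have "\<dots> \<le> integral {s..t} D"
        using q D0 absolutely_integrable_on_Icc(2)[OF D] by (intro integral_subset_le) auto
      finally show "w s t \<le> integral {s..t} D + e" by simp
    qed
  qed
  \<comment> \<open>From below, each base point \<open>q\<close> contributes |h q| to the limit
    inferior, and the supremum of these is \<open>D\<close>. From above, \<open>wD\<close> and
    Lebesgue differentiation of \<open>D\<close> give the matching bound.\<close>
  have "AE t in lebesgue. t \<in> {a<..<b} \<longrightarrow> ((\<lambda>s. w t s / \<bar>t - s\<bar>) \<longlongrightarrow> D t) (at t)"
    using AE_h_ratio AE_ratio[OF D] AE_D0
  proof eventually_elim
    case (elim x)
    show ?case
    proof (intro impI order_tendstoI)
      fix c assume x: "x \<in> {a<..<b}" and c: "c < D x"
      show "\<forall>\<^sub>F s in at x. c < w x s / \<bar>x - s\<bar>"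
      proof (cases "c < 0")
        case True
        then show ?thesis using nonneg by (auto intro!: always_eventually less_le_trans[OF True])
      next
        case False
        then have "ennreal c < D0 x" using elim(3) x c by (simp add: ennreal_lessI)
        then obtain q where q: "q \<in> Q" "ennreal c < ennreal \<bar>h q x\<bar>"
          unfolding D0_def less_SUP_iff by blast
        have qi: "q \<in> {a..b}" using q Q by auto
        have "c < \<bar>h q x\<bar>" using q(2) False by (simp add: ennreal_less_iff)
        moreover have "((\<lambda>y. \<bar>ratio (h q) x y\<bar>) \<longlongrightarrow> \<bar>h q x\<bar>) (at x)"
          using elim(1) q(1) by (intro tendsto_rabs) blast
        ultimately have "\<forall>\<^sub>F y in at x. c < \<bar>ratio (h q) x y\<bar>"
          by (intro order_tendstoD(1))
        then show ?thesis using near[OF x]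
        proof eventually_elim
          case (elim y)
          have "\<bar>ratio (h q) x y\<bar> = \<bar>w q y - w q x\<bar> / \<bar>y - x\<bar>" using ratio_h[OF qi x] elim by simp
          also have "\<dots> \<le> w x y / \<bar>y - x\<bar>"
            using lip[OF qi, of x y] x elim by (intro divide_right_mono) auto
          finally show ?case using elim by (simp add: abs_minus_commute)
        qed
      qed
    next
      fix c assume x: "x \<in> {a<..<b}" and c: "D x < c"
      have "\<forall>\<^sub>F y in at x. ratio D x y < c" using elim(2) c by (intro order_tendstoD(2))
      then show "\<forall>\<^sub>F s in at x. w x s / \<bar>x - s\<bar> < c" using near[OF x]
      proof eventually_elim
        case (elim y)
        have "w x y / \<bar>x - y\<bar> \<le> ratio D x y"
          using wD[of x y] wD[of y x] sym[of x y] x elim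
          by (cases "x \<le> y") (auto simp: ratio_def abs_minus_commute intro!: divide_right_mono)
        then show ?case using elim by simp
      qed
    qed
  qed
  then show thesis using that D D0 wD by blast
qed

section \<open>Dissipation along curves of maximal slope\<close>

text \<open>After translation the integrals over the common part cancel. What remains is the
  integral over [b, b + d] minus that over [a, a + d], and monotonicity bounds each by an extreme
  value.\<close>

lemma integral_increment_mono_le:
  fixes f :: "real \<Rightarrow> real"
  assumes f: "mono f" and "a \<le> b" "0 < d"
  shows "(\<lambda>t. f (t + d) - f t) integrable_on {a..b}"
    "integral {a..b} (\<lambda>t. f (t + d) - f t) \<le> d * (f (b + d) - f a)"
proof -
  have int: "f integrable_on {x..y}" for x y
    using f by (intro integrable_on_mono_on) (auto simp: mono_on_def mono_def)
  have "((\<lambda>t. f (t + d)) has_integral integral {a + d..b + d} f) {a..b}"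
    using has_integral_shift_cbox_iff[of f d _ a b] int[of "a + d" "b + d"]
    by (simp add: comp_def add.commute integrable_integral)
  then have shift: "((\<lambda>t. f (t + d) - f t) has_integral (integral {a + d..b + d} f - integral {a..b} f)) {a..b}"
    using int by (intro has_integral_diff integrable_integral) auto
  then show "(\<lambda>t. f (t + d) - f t) integrable_on {a..b}" by blast
  have "integral {a..a + d} f + integral {a + d..b + d} f = integral {a..b + d} f"
       "integral {a..b} f + integral {b..b + d} f = integral {a..b + d} f"
    using assms int by (auto intro!: Henstock_Kurzweil_Integration.integral_combine)
  moreover have "integral {a..a + d} (\<lambda>_. f a) \<le> integral {a..a + d} f"
    using f int by (intro integral_le) (auto simp: mono_def)
  moreover have "integral {b..b + d} f \<le> integral {b..b + d} (\<lambda>_. f (b + d))"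
    using f int by (intro integral_le) (auto simp: mono_def)
  ultimately show "integral {a..b} (\<lambda>t. f (t + d) - f t) \<le> d * (f (b + d) - f a)"
    using shift \<open>0 < d\<close> by (simp add: integral_unique algebra_simps)
qed

text \<open>Fatou's lemma for the difference quotients.\<close>
lemma nn_integral_derivative_antimono_le:
  fixes \<phi> g :: "real \<Rightarrow> real"
  assumes anti: "antimono_on {0..} \<phi>" and "0 \<le> a" "a \<le> b"
    and deriv: "AE t in lebesgue. t \<in> {a..b} \<longrightarrow> (\<phi> has_real_derivative - g t) (at t within {0..})"
  obtains u where "u \<in> borel_measurable lebesgue"
    "AE t in lebesgue. t \<in> {a..b} \<longrightarrow> u t = ennreal (g t)"
    "(\<integral>\<^sup>+t. u t * indicator {a..b} t \<partial>lebesgue) \<le> ennreal (\<phi> a - \<phi> (b + 1))"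
proof -
  \<comment> \<open>Extending by the value at 0 gives a function monotone on the whole line, hence
    Borel.\<close>
  define f where "f t = - \<phi> (max 0 t)" for t
  have f: "mono f"
    using anti by (auto simp: mono_def f_def monotone_on_def)
  \<comment> \<open>Steps of length at most 1 keep the quotients on [a, b] from looking beyond b +
    1; this is where \<open>\<phi> (b + 1)\<close> in the bound comes from.\<close>
  define d where "d n = inverse (real (Suc n))" for n
  have d: "0 < d n" "d n \<le> 1" for n by (auto simp: d_def inverse_le_1_iff)
  define k where "k n t = (f (t + d n) - f t) / d n" for n t
  have k0: "0 \<le> k n t" for n t using f d[of n] by (auto simp: k_def mono_def)
  have "(\<lambda>t. f (t + d n)) \<in> borel_measurable borel" for n
    using f by (intro borel_measurable_mono) (auto simp: mono_def)
  then have "k n \<in> borel_measurable borel" for n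
    unfolding k_def using borel_measurable_mono[OF f] by measurable
  then have k_meas [measurable]: "k n \<in> borel_measurable lebesgue" for n
    by (intro measurable_completion) simp
  have k_int: "(\<integral>\<^sup>+t. ennreal (k n t) * indicator {a..b} t \<partial>lebesgue) \<le> ennreal (\<phi> a - \<phi> (b + 1))" for n
  proof -
    have int: "k n integrable_on {a..b}"
      using integral_increment_mono_le(1)[OF f \<open>a \<le> b\<close> d(1)]
      unfolding k_def divide_inverse by (intro integrable_on_mult_left)
    have "(\<integral>\<^sup>+t. ennreal (k n t) * indicator {a..b} t \<partial>lebesgue) = ennreal (integral {a..b} (k n))"
      by (intro nn_integral_eq_HK_integral nonnegative_absolutely_integrable_1 int k0)
    also have "integral {a..b} (k n) = integral {a..b} (\<lambda>t. f (t + d n) - f t) / d n"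
      unfolding k_def by simp
    also have "\<dots> \<le> d n * (f (b + d n) - f a) / d n"
      using integral_increment_mono_le(2)[OF f \<open>a \<le> b\<close> d(1)[of n]] d[of n] by (intro divide_right_mono) auto
    also have "\<dots> = f (b + d n) - f a" using d(1)[of n] by simp
    also have "\<dots> \<le> f (b + 1) - f a" using f d(2)[of n] by (simp add: mono_def)
    also have "\<dots> = \<phi> a - \<phi> (b + 1)" using assms by (simp add: f_def)
    finally show ?thesis by (simp add: ennreal_leI)
  qed
  \<comment> \<open>No measurability of \<open>g\<close> is assumed; this limit inferior is a
    measurable function equal to it wherever the derivative exists.\<close>
  define u where "u t = liminf (\<lambda>n. ennreal (k n t))" for t
  show thesis
  proof (rule that[of u])
    show u_meas: "u \<in> borel_measurable lebesgue" unfolding u_def by measurable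
    show "AE t in lebesgue. t \<in> {a..b} \<longrightarrow> u t = ennreal (g t)"
      using deriv
    proof eventually_elim
      case (elim t)
      show ?case
      proof
        assume t: "t \<in> {a..b}"
        have lim: "((\<lambda>y. (\<phi> y - \<phi> t) / (y - t)) \<longlongrightarrow> - g t) (at t within {0..})"
          using elim t by (simp add: has_field_derivative_iff)
        have "0 < t + d n" for n using d(1)[of n] t \<open>0 \<le> a\<close> by (auto intro: add_nonneg_pos)
        moreover have "(\<lambda>n. t + d n) \<longlonglongrightarrow> t + 0"
          unfolding d_def by (intro tendsto_intros LIMSEQ_inverse_real_of_nat)
        ultimately have "filterlim (\<lambda>n. t + d n) (at t within {0..}) sequentially"
          using d(1) unfolding filterlim_at by (auto simp: less_imp_neq[symmetric] intro!: always_eventually less_imp_le)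
        from filterlim_compose[OF lim this]
        have "(\<lambda>n. - ((\<phi> (t + d n) - \<phi> t) / (t + d n - t))) \<longlonglongrightarrow> - (- g t)"
          by (rule tendsto_minus)
        moreover have "- ((\<phi> (t + d n) - \<phi> t) / (t + d n - t)) = k n t" for n
          using t \<open>0 \<le> a\<close> d(1)[of n] by (simp add: k_def f_def field_simps)
        ultimately have "(\<lambda>n. k n t) \<longlonglongrightarrow> g t" by simp
        then have "(\<lambda>n. ennreal (k n t)) \<longlonglongrightarrow> ennreal (g t)" by (rule tendsto_ennrealI)
        then show "u t = ennreal (g t)" unfolding u_def by (intro lim_imp_Liminf) auto
      qed
    qed
    have "(\<integral>\<^sup>+t. u t * indicator {a..b} t \<partial>lebesgue) = (\<integral>\<^sup>+t. liminf (\<lambda>n. ennreal (k n t) * indicator {a..b} t) \<partial>lebesgue)"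
      by (intro nn_integral_cong) (auto simp: u_def indicator_def Liminf_const)
    also have "\<dots> \<le> liminf (\<lambda>n. \<integral>\<^sup>+t. ennreal (k n t) * indicator {a..b} t \<partial>lebesgue)"
      by (intro nn_integral_liminf borel_measurable_times_ennreal borel_measurable_indicator
          measurable_compose[OF k_meas]) auto
    also have "\<dots> \<le> limsup (\<lambda>n. \<integral>\<^sup>+t. ennreal (k n t) * indicator {a..b} t \<partial>lebesgue)"
      by (intro Liminf_le_Limsup) auto
    also have "\<dots> \<le> ennreal (\<phi> a - \<phi> (b + 1))"
      using k_int by (intro Limsup_bounded always_eventually) auto
    finally show "(\<integral>\<^sup>+t. u t * indicator {a..b} t \<partial>lebesgue) \<le> ennreal (\<phi> a - \<phi> (b + 1))" .
  qed
qed

section \<open>Dissipation controls distance and slope\<close>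

text \<open>Identifies the abstract density with \<open>mderiv\<close>. On the open interval the
  limit within [0, \<infinity>) is the ordinary two-sided one, so \<open>Lim\<close> returns it
  wherever it exists.\<close>

lemma AC_infty_metric_derivative:
  fixes \<rho> :: "real \<Rightarrow> 'a::polish_space measure"
  assumes p: "1 < p" and AC: "AC_infty p \<rho>" and "0 < T"
  obtains D where "D absolutely_integrable_on UNIV" "\<forall>x. 0 \<le> D x"
    "\<forall>s t. 0 \<le> s \<longrightarrow> s \<le> t \<longrightarrow> t \<le> T \<longrightarrow> Wass p (\<rho> s) (\<rho> t) \<le> integral {s..t} D"
    "AE t in lebesgue. t \<in> {0<..<T} \<longrightarrow> D t = mderiv p {0..} \<rho> t"
proof -
  have P: "\<rho> t \<in> Prob_p p" if "0 \<le> t" for t using AC that by (simp add: AC_infty_def)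
  obtain m where m: "m absolutely_integrable_on {0..T}"
    and m_le: "\<And>s t. 0 \<le> s \<Longrightarrow> s < t \<Longrightarrow> t \<le> T \<Longrightarrow> Wass p (\<rho> t) (\<rho> s) \<le> (LINT u:{s..t}|lebesgue. m u)"
  proof -
    have "AC_on p T \<rho>" using AC \<open>0 < T\<close> by (simp add: AC_infty_def)
    then show thesis using that unfolding AC_on_def by auto
  qed
  define w where "w s t = Wass p (\<rho> s) (\<rho> t)" for s t
  have dom: "w s t \<le> integral {s..t} m" if "0 \<le> s" "s < t" "t \<le> T" for s t
  proof -
    have "m absolutely_integrable_on {s..t}" using m by (rule set_integrable_subset) (use that in auto)
    then show ?thesis
      using m_le[OF that] by (simp add: w_def Wass_sym[of p "\<rho> s"] set_lebesgue_integral_eq_integral(2))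
  qed
  obtain D where D: "D absolutely_integrable_on UNIV" "\<forall>x. 0 \<le> D x"
    "\<forall>s t. 0 \<le> s \<longrightarrow> s \<le> t \<longrightarrow> t \<le> T \<longrightarrow> w s t \<le> integral {s..t} D"
    "AE t in lebesgue. t \<in> {0<..<T} \<longrightarrow> ((\<lambda>s. w t s / \<bar>t - s\<bar>) \<longlongrightarrow> D t) (at t)"
  proof (rule metric_derivative_exists[OF m, of w])
    show "w t t = 0" if "t \<in> {0..T}" for t
      using P[of t] that p by (simp add: w_def Wass_refl Prob_p_def)
    show "w r t \<le> w r s + w s t" if "r \<in> {0..T}" "s \<in> {0..T}" "t \<in> {0..T}" for r s t
      unfolding w_def using p that P by (intro Wass_triangle) auto
  qed (use dom Wass_nonneg Wass_sym in \<open>auto simp: w_def\<close>)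
  have "AE t in lebesgue. t \<in> {0<..<T} \<longrightarrow> D t = mderiv p {0..} \<rho> t"
    using D(4)
  proof eventually_elim
    case (elim t)
    show ?case
    proof
      assume t: "t \<in> {0<..<T}"
      then have at: "at t within {0..} = at t" by (intro at_within_interior) auto
      show "D t = mderiv p {0..} \<rho> t"
        using elim t unfolding mderiv_def at w_def by (intro tendsto_Lim[symmetric]) auto
    qed
  qed
  then show thesis using D(1,2,3) unfolding w_def by (intro that) auto
qed

text \<open>Either x <= e, or x = x^(1-p) x^p where the first factor is at most e^(1-p).\<close>

lemma le_add_powr:
  fixes x e p :: real
  assumes "0 \<le> x" "0 < e" "1 \<le> p"
  shows "x \<le> e + e powr (1 - p) * x powr p"
proof (cases "x \<le> e")
  case True
  then show ?thesis by (intro add_increasing2) auto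
next
  case False
  then have "x powr (1 - p) \<le> e powr (1 - p)" using assms by (intro powr_mono2') auto
  then have "x powr (1 - p) * x powr p \<le> e powr (1 - p) * x powr p" by (rule mult_right_mono) simp
  moreover have "x powr (1 - p) * x powr p = x" using False assms by (simp add: powr_add[symmetric])
  ultimately show ?thesis using assms by simp
qed

text \<open>The dissipation over \<open>[t, t + 2]\<close> tends to zero. On \<open>[t, t + 1]\<close> it controls the distance
  travelled and it bounds the slope at some point of every full-measure set.\<close>
lemma eventually_close_to_small_slope:
  fixes \<rho> :: "real \<Rightarrow> 'a::polish_space measure" and G :: "'a measure \<Rightarrow> ennreal"
  assumes p: "1 < p" and AC: "AC_infty p \<rho>" and anti: "antimono_on {0..} \<phi>"
    and bdd: "\<And>t. 0 \<le> t \<Longrightarrow> c \<le> \<phi> t"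
    and slope: "AE t in lebesgue. t \<in> {0..} \<longrightarrow> (\<phi> has_real_derivative
       (- ((mderiv p {0..} \<rho> t) powr p) / p - ((enn2real (G (\<rho> t))) powr (p/(p-1))) / (p/(p-1)))) (at t within {0..})"
    and R: "AE t in lebesgue. t \<in> {0..} \<longrightarrow> R t" and \<eta>: "0 < \<eta>"
  shows "\<forall>\<^sub>F t in at_top. \<exists>s\<ge>t. Wass p (\<rho> t) (\<rho> s) \<le> \<eta> \<and>
    (enn2real (G (\<rho> s))) powr (p/(p-1)) / (p/(p-1)) \<le> \<eta> \<and> R s"
proof -
  define e where "e = \<eta> / 2"
  have e: "0 < e" using \<eta> by (simp add: e_def)
  \<comment> \<open>The first bound makes e + e^(1-p) * p * \<delta> at most 2 e = \<eta>, which
    controls the distance; the second one controls the slope term.\<close>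
  define \<delta> where "\<delta> = min (e powr p / p) \<eta>"
  have \<delta>: "0 < \<delta>" using e \<eta> p by (simp add: \<delta>_def)
  have q: "0 < p / (p - 1)" using p by simp
  have anti': "\<phi> t \<le> \<phi> s" if "0 \<le> s" "s \<le> t" for s t
    using anti that by (auto simp: monotone_on_def)
  have bb: "bdd_below (\<phi> ` {0..})" using bdd by (auto intro!: bdd_belowI)
  have "\<exists>x\<in>\<phi> ` {0..}. x < Inf (\<phi> ` {0..}) + \<delta>"
    by (intro cInf_lessD) (use \<delta> in auto)
  then obtain A where A: "0 \<le> A" "\<phi> A < Inf (\<phi> ` {0..}) + \<delta>" by auto
  define X where "X t = enn2real (G (\<rho> t)) powr (p/(p-1)) / (p/(p-1))" for t
  have X: "0 \<le> X t" for t unfolding X_def by (rule divide_nonneg_pos[OF powr_ge_zero q])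
  \<comment> \<open>Values of \<open>powr\<close> are never negative, so \<open>g\<close> dominates
    both of its terms even at times where \<open>mderiv\<close> is not a genuine limit.\<close>
  define g where "g t = (mderiv p {0..} \<rho> t) powr p / p + X t" for t
  have g: "(mderiv p {0..} \<rho> t) powr p \<le> p * g t" "X t \<le> g t" "0 \<le> g t" for t
    using p X[of t] by (simp_all add: g_def distrib_left)
  have slope': "AE t in lebesgue. t \<in> {0..} \<longrightarrow> (\<phi> has_real_derivative - g t) (at t within {0..})"
    using slope unfolding g_def X_def by simp
  have "\<exists>s\<ge>t. Wass p (\<rho> t) (\<rho> s) \<le> \<eta> \<and>
    (enn2real (G (\<rho> s))) powr (p/(p-1)) / (p/(p-1)) \<le> \<eta> \<and> R s" if "max A 1 \<le> t" for t
  proof -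
    \<comment> \<open>Positivity of \<open>t\<close> places [t, t + 1] inside the open interval (0,
      t + 2) on which \<open>D\<close> agrees almost everywhere with the metric derivative.\<close>
    have t: "0 < t" "A \<le> t" using that by auto
    \<comment> \<open>The second unit in t + 1 + 1 is the look-ahead of the difference quotients in
      the Fatou estimate.\<close>
    have "Inf (\<phi> ` {0..}) \<le> \<phi> (t + 1 + 1)" using bb t by (intro cInf_lower) auto
    then have small: "\<phi> t - \<phi> (t + 1 + 1) < \<delta>" using A anti'[of A t] t by simp
    obtain u where u: "u \<in> borel_measurable lebesgue"
      "AE s in lebesgue. s \<in> {t..t + 1} \<longrightarrow> u s = ennreal (g s)"
      "(\<integral>\<^sup>+s. u s * indicator {t..t + 1} s \<partial>lebesgue) \<le> ennreal (\<phi> t - \<phi> (t + 1 + 1))"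
    proof (rule nn_integral_derivative_antimono_le[OF anti, of t "t + 1" g])
      show "AE s in lebesgue. s \<in> {t..t + 1} \<longrightarrow> (\<phi> has_real_derivative - g s) (at s within {0..})"
        using slope' by eventually_elim (use t in auto)
    qed (use t in auto)
    note [measurable] = u(1)
    have u_less: "(\<integral>\<^sup>+s. u s * indicator {t..t + 1} s \<partial>lebesgue) < ennreal \<delta>"
      using u(3) small \<delta> by (meson ennreal_lessI le_less_trans)
    obtain D where D: "D absolutely_integrable_on UNIV" "\<forall>x. 0 \<le> D x"
      "\<forall>s r. 0 \<le> s \<longrightarrow> s \<le> r \<longrightarrow> r \<le> t + 2 \<longrightarrow> Wass p (\<rho> s) (\<rho> r) \<le> integral {s..r} D"
      "AE s in lebesgue. s \<in> {0<..<t + 2} \<longrightarrow> D s = mderiv p {0..} \<rho> s"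
      using AC_infty_metric_derivative[OF p AC, of "t + 2"] t by auto
    have "ennreal (integral {t..t + 1} D) = (\<integral>\<^sup>+s. ennreal (D s) * indicator {t..t + 1} s \<partial>lebesgue)"
      using D(2) absolutely_integrable_on_Icc(1)[OF D(1)] by (intro nn_integral_eq_HK_integral[symmetric]) auto
    also have "\<dots> \<le> (\<integral>\<^sup>+s. ennreal e * indicator {t..t + 1} s + ennreal (e powr (1 - p) * p) * (u s * indicator {t..t + 1} s) \<partial>lebesgue)"
      using D(4) u(2)
    proof (intro nn_integral_mono_AE, eventually_elim)
      fix s assume s: "s \<in> {0<..<t + 2} \<longrightarrow> D s = mderiv p {0..} \<rho> s" "s \<in> {t..t + 1} \<longrightarrow> u s = ennreal (g s)"
      show "ennreal (D s) * indicator {t..t + 1} s \<le> ennreal e * indicator {t..t + 1} s + ennreal (e powr (1 - p) * p) * (u s * indicator {t..t + 1} s)"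
      proof (cases "s \<in> {t..t + 1}")
        case True
        have "D s \<le> e + e powr (1 - p) * D s powr p" using D(2) e p by (intro le_add_powr) auto
        also have "D s powr p \<le> p * g s" using s(1) True t g(1)[of s] by simp
        finally have "D s \<le> e + e powr (1 - p) * p * g s" using e by (simp add: mult.assoc mult_left_mono)
        then have "ennreal (D s) \<le> ennreal (e + e powr (1 - p) * p * g s)" by (rule ennreal_leI)
        then show ?thesis using True s(2) e p g(3)[of s] by (simp add: ennreal_mult)
      qed simp
    qed
    also have "\<dots> = ennreal e + ennreal (e powr (1 - p) * p) * (\<integral>\<^sup>+s. u s * indicator {t..t + 1} s \<partial>lebesgue)"
    proof -
      have *: "(\<lambda>s. u s * indicator {t..t + 1} s) \<in> borel_measurable lebesgue"
        by (intro borel_measurable_times_ennreal borel_measurable_indicator u(1)) auto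
      have "(\<integral>\<^sup>+s. ennreal e * indicator {t..t + 1} s \<partial>lebesgue) = ennreal e"
        by (subst nn_integral_cmult_indicator) auto
      moreover have "(\<lambda>s. ennreal e * indicator {t..t + 1} s) \<in> borel_measurable lebesgue"
        by (intro borel_measurable_times_ennreal borel_measurable_indicator) auto
      moreover have "(\<lambda>s. ennreal (e powr (1 - p) * p) * (u s * indicator {t..t + 1} s)) \<in> borel_measurable lebesgue"
        by (intro borel_measurable_times_ennreal * measurable_const) auto
      ultimately show ?thesis
        by (simp only: nn_integral_add nn_integral_cmult[OF *])
    qed
    also have "\<dots> \<le> ennreal e + ennreal (e powr (1 - p) * p) * ennreal (e powr p / p)"
    proof (intro add_left_mono mult_left_mono)
      have "ennreal \<delta> \<le> ennreal (e powr p / p)" by (intro ennreal_leI) (simp add: \<delta>_def)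
      then show "(\<integral>\<^sup>+s. u s * indicator {t..t + 1} s \<partial>lebesgue) \<le> ennreal (e powr p / p)"
        using u_less by simp
    qed simp
    also have "\<dots> = ennreal (e + e powr (1 - p) * p * (e powr p / p))"
    proof -
      have "ennreal e + ennreal c * ennreal d = ennreal (e + c * d)" if "0 \<le> c" "0 \<le> d" for c d
        using that e by (simp add: ennreal_mult)
      then show ?thesis using p by simp
    qed
    also have "e + e powr (1 - p) * p * (e powr p / p) = \<eta>"
      using e p by (simp add: powr_add[symmetric]) (simp add: e_def)
    finally have D_le: "integral {t..t + 1} D \<le> \<eta>" using \<eta> by simp
    \<comment> \<open>Otherwise the dissipation density would be at least \<open>\<delta>\<close>
      almost everywhere on an interval of length one, contradicting \<open>u_less\<close>.\<close>
    have "\<exists>s\<in>{t..t + 1}. g s < \<delta> \<and> R s"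
    proof (rule ccontr)
      assume neg: "\<not> (\<exists>s\<in>{t..t + 1}. g s < \<delta> \<and> R s)"
      have "ennreal \<delta> = (\<integral>\<^sup>+s. ennreal \<delta> * indicator {t..t + 1} s \<partial>lebesgue)"
        by (subst nn_integral_cmult_indicator) auto
      also have "\<dots> \<le> (\<integral>\<^sup>+s. u s * indicator {t..t + 1} s \<partial>lebesgue)"
        using u(2) R
      proof (intro nn_integral_mono_AE, eventually_elim)
        fix s assume s: "s \<in> {t..t + 1} \<longrightarrow> u s = ennreal (g s)" "s \<in> {0..} \<longrightarrow> R s"
        show "ennreal \<delta> * indicator {t..t + 1} s \<le> u s * indicator {t..t + 1} s"
          using s neg t by (cases "s \<in> {t..t + 1}") (auto intro!: ennreal_leI simp: not_less)
      qed
      finally show False using u_less by simp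
    qed
    then obtain s where s: "s \<in> {t..t + 1}" "g s < \<delta>" "R s" by blast
    have "Wass p (\<rho> t) (\<rho> s) \<le> integral {t..s} D" using D(3) t s by auto
    also have "\<dots> \<le> integral {t..t + 1} D"
      using s D(2) absolutely_integrable_on_Icc(2)[OF D(1)] by (intro integral_subset_le) auto
    finally have "Wass p (\<rho> t) (\<rho> s) \<le> \<eta>" using D_le by simp
    moreover have "(enn2real (G (\<rho> s))) powr (p/(p-1)) / (p/(p-1)) \<le> \<eta>"
      using g(2)[of s] s(2) unfolding \<delta>_def X_def by linarith
    ultimately show ?thesis using s by auto
  qed
  then show ?thesis unfolding eventually_at_top_linorder by blast
qed

section \<open>Convergence to weak stationary states\<close>

lemma dLP_set_le_dLP:
  assumes "S \<subseteq> Prob" "\<nu> \<in> Prob" "\<mu> \<in> S"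
  shows "dLP_set \<nu> S \<le> dLP \<nu> \<mu>"
  unfolding dLP_set_def
proof (rule cINF_lower[OF _ assms(3)])
  show "bdd_below (dLP \<nu> ` S)" using assms dLP_nonneg by (intro bdd_belowI[of _ 0]) auto
qed

lemma dLP_set_nonneg:
  assumes "S \<subseteq> Prob" "S \<noteq> {}" "\<nu> \<in> Prob"
  shows "0 \<le> dLP_set \<nu> S"
  unfolding dLP_set_def using assms dLP_nonneg by (intro cINF_greatest) auto

lemma dLP_tendsto_zero_if_Wass:
  fixes M N :: "nat \<Rightarrow> 'a::polish_space measure"
  assumes "0 < p" "\<And>n. M n \<in> Prob_p p" "\<And>n. N n \<in> Prob_p p"
    and W: "(\<lambda>n. Wass p (M n) (N n)) \<longlonglongrightarrow> 0"
  shows "(\<lambda>n. dLP (M n) (N n)) \<longlonglongrightarrow> 0"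
proof (rule order_tendstoI)
  have P: "M n \<in> Prob" "N n \<in> Prob" for n using assms by (auto simp: Prob_p_def)
  fix e :: real
  show "\<forall>\<^sub>F n in sequentially. e < dLP (M n) (N n)" if "e < 0"
    by (intro always_eventually allI less_le_trans[OF that dLP_nonneg] P)
  assume e: "0 < e"
  \<comment> \<open>Halving \<open>e\<close> turns the weak inequality of \<open>dLP_le\<close> into
    the strict one required.\<close>
  then have "0 < (e / 2) powr (1 + 1/p)" by simp
  from order_tendstoD(2)[OF W this]
  show "\<forall>\<^sub>F n in sequentially. dLP (M n) (N n) < e"
  proof eventually_elim
    case (elim n)
    have "LP_bound (M n) (N n) (e / 2)" using elim e assms by (intro LP_bound_if_Wass[of p]) auto
    from dLP_le[OF this] show ?case using e by simp
  qed
qed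

text \<open>If the distance stayed at least \<open>e\<close> at arbitrarily late times, one could
  pick such a time satisfying \<open>near n\<close> for each n, and a limit in \<open>S\<close>
  along a subsequence would contradict this. The sequence of times need not tend to infinity:
  \<open>near n\<close> carries all that is gained from late times. The same selection shows that
  \<open>S\<close> is nonempty, without which the infimum would be meaningless.\<close>

lemma dLP_set_tendsto_zero:
  fixes \<rho> :: "real \<Rightarrow> 'a::polish_space measure"
  assumes S: "S \<subseteq> Prob" and P: "\<And>t. 0 \<le> t \<Longrightarrow> \<rho> t \<in> Prob"
    and near: "\<And>n::nat. \<forall>\<^sub>F t in at_top. near n t"
    and lim: "\<And>t. \<forall>n. 0 \<le> t n \<and> near n (t n) \<Longrightarrow> \<exists>r \<mu>. strict_mono r \<and> \<mu> \<in> S \<and> narrow_conv (\<lambda>n. \<rho> (t (r n))) \<mu>"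
  shows "S \<noteq> {} \<and> ((\<lambda>t. dLP_set (\<rho> t) S) \<longlongrightarrow> 0) at_top"
proof
  have near': "\<forall>\<^sub>F t in at_top. 0 \<le> t \<and> near n t" for n
    using near[of n] eventually_ge_at_top[of 0] by eventually_elim auto
  have "\<exists>t. 0 \<le> t \<and> near n t" for n
    using eventually_happens[OF near'[of n]] by auto
  then obtain t where "\<forall>n. 0 \<le> t n \<and> near n (t n)" by metis
  from lim[OF this] show ne: "S \<noteq> {}" by auto
  show "((\<lambda>t. dLP_set (\<rho> t) S) \<longlongrightarrow> 0) at_top"
  proof (rule order_tendstoI)
    fix e :: real
    show "\<forall>\<^sub>F t in at_top. e < dLP_set (\<rho> t) S" if "e < 0"
      using eventually_ge_at_top[of 0]
      by eventually_elim (use that dLP_set_nonneg[OF S ne P] in \<open>auto intro: less_le_trans\<close>)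
    assume e: "0 < e"
    show "\<forall>\<^sub>F t in at_top. dLP_set (\<rho> t) S < e"
    proof (rule ccontr)
      assume "\<not> (\<forall>\<^sub>F t in at_top. dLP_set (\<rho> t) S < e)"
      then have fr: "\<exists>\<^sub>F t in at_top. \<not> dLP_set (\<rho> t) S < e" by (simp add: not_eventually)
      have "\<exists>t. (0 \<le> t \<and> near n t) \<and> \<not> dLP_set (\<rho> t) S < e" for n
        using frequently_ex[OF frequently_eventually_conj[OF fr near'[of n]]] .
      then obtain t where t: "\<forall>n. (0 \<le> t n \<and> near n (t n)) \<and> \<not> dLP_set (\<rho> (t n)) S < e" by metis
      then have "\<forall>n. 0 \<le> t n \<and> near n (t n)" by blast
      from lim[OF this] obtain r \<mu> where \<mu>: "\<mu> \<in> S" "narrow_conv (\<lambda>n. \<rho> (t (r n))) \<mu>" by blast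
      have "(\<lambda>n. dLP (\<rho> (t (r n))) \<mu>) \<longlonglongrightarrow> 0" using \<mu>(2) by (simp add: narrow_conv_def)
      from eventually_happens[OF order_tendstoD(2)[OF this e]]
      obtain n where "dLP (\<rho> (t (r n))) \<mu> < e" by auto
      moreover have "0 \<le> t (r n)" using t by blast
      ultimately have "dLP_set (\<rho> (t (r n))) S < e"
        using dLP_set_le_dLP[OF S P \<mu>(1), of "t (r n)"] by linarith
      then show False using t by blast
    qed
  qed
qed

theorem theorem2p17:
  fixes p :: real
    and E Et :: "('a::polish_space) measure \<Rightarrow> ereal"
    and G Gt :: "'a measure \<Rightarrow> ennreal"
    and \<rho> :: "real \<Rightarrow> 'a measure"
  assumes p: "1 < p"
    and E_proper: "(\<forall>\<mu>\<in>Prob_p p. E \<mu> \<noteq> -\<infinity>) \<and> (\<exists>\<mu>\<in>Prob_p p. E \<mu> < \<infinity>)"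
    and G_wug: "weak_upper_gradient p E G"
    and ext_E: "\<forall>\<mu>\<in>Prob_p p. Et \<mu> = E \<mu>"
    and ext_G: "\<forall>\<mu>\<in>Prob_p p. Gt \<mu> = G \<mu>"
    and B1: "(\<forall>\<mu>\<in>Prob. Et \<mu> \<noteq> -\<infinity>) \<and> (\<exists>\<mu>\<in>Prob. Et \<mu> < \<infinity>) \<and>
             (\<exists>c::real. \<forall>\<mu>\<in>Prob. ereal c \<le> Et \<mu>) \<and> lsc_narrow Et"
    and B3: "lsc_narrow Gt"
    and existence: "\<forall>\<rho>0\<in>Z_set p E. \<exists>\<rho>'. max_slope_curve p E G \<rho>' \<and> \<rho>' 0 = \<rho>0"
    and curve: "max_slope_curve p E G \<rho>" and start: "\<rho> 0 \<in> Z_set p E"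
    and B2_or_B2': "(\<forall>C::real. rel_compact_narrow {\<mu>\<in>Prob. Et \<mu> \<le> ereal C}) \<or>
        (\<exists>Y. Y \<subseteq> Prob \<and> (\<forall>t\<ge>0. \<rho> t \<in> Y) \<and>
             (\<forall>C::real. rel_compact_narrow {\<mu>\<in>Prob_p p \<inter> Y. E \<mu> \<le> ereal C}))"
  shows "weak_stationary Et Gt \<noteq> {} \<and>
         ((\<lambda>t. dLP_set (\<rho> t) (weak_stationary Et Gt)) \<longlongrightarrow> 0) at_top \<and>
         (\<forall>Y. Y \<subseteq> Prob \<and> (\<forall>t\<ge>0. \<rho> t \<in> Y) \<and>
              (\<forall>C::real. rel_compact_narrow {\<mu>\<in>Prob_p p \<inter> Y. E \<mu> \<le> ereal C}) \<and>
              closed_narrow Y \<longrightarrow>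
            weak_stationary Et Gt \<inter> Y \<noteq> {} \<and>
            ((\<lambda>t. dLP_set (\<rho> t) (weak_stationary Et Gt \<inter> Y)) \<longlongrightarrow> 0) at_top)"
proof -
  have AC: "AC_infty p \<rho>" using curve by (simp add: max_slope_curve_def)
  have Pp: "\<rho> t \<in> Prob_p p" if "0 \<le> t" for t using AC that by (simp add: AC_infty_def)
  then have P: "\<rho> t \<in> Prob" if "0 \<le> t" for t using that by (simp add: Prob_p_def)
  obtain \<phi> where \<phi>E: "AE t\<in>{0::real..} in lebesgue. E (\<rho> t) = ereal (\<phi> t)"
    and anti: "antimono_on {0::real..} \<phi>"
    and slope: "AE t\<in>{0::real..} in lebesgue. G (\<rho> t) < \<infinity> \<and>
              (\<phi> has_real_derivative
                 (- ((mderiv p {0::real..} \<rho> t) powr p) / p - ((enn2real (G (\<rho> t))) powr (p/(p-1))) / (p/(p-1))))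
              (at t within {0::real..})"
    using curve unfolding max_slope_curve_def by blast
  obtain c where c: "\<And>\<mu>. \<mu> \<in> Prob \<Longrightarrow> ereal c \<le> Et \<mu>" using B1 by blast
  have anti': "\<phi> t \<le> \<phi> s" if "0 \<le> s" "s \<le> t" for s t
    using anti that by (auto simp: monotone_on_def)
  \<comment> \<open>The energy bound is known for \<open>\<phi>\<close> only at almost every time.
    If \<open>\<phi> t\<close> were below \<open>c\<close>, monotonicity would propagate this to the
    whole of [t, t + 1], which is not a null set.\<close>
  have bdd: "c \<le> \<phi> t" if "0 \<le> t" for t
  proof (rule ccontr)
    assume "\<not> c \<le> \<phi> t"
    then have "AE s in lebesgue. s \<notin> {t..t + 1}"
      using \<phi>E
    proof (elim eventually_mono, intro notI)
      fix s assume "s \<in> {0..} \<longrightarrow> E (\<rho> s) = ereal (\<phi> s)" "s \<in> {t..t + 1}" and neg: "\<not> c \<le> \<phi> t"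
      then have "ereal c \<le> ereal (\<phi> s)" "\<phi> s \<le> \<phi> t"
        using c[OF P, of s] ext_E Pp[of s] anti'[of t s] that by auto
      then show False using neg by simp
    qed
    then have "emeasure lebesgue {t..t + 1} = 0"
      by (subst (asm) AE_iff_measurable[of "{t..t + 1}"]) auto
    then show False by simp
  qed
  \<comment> \<open>The selected time must also satisfy these almost everywhere properties: the
    first places \<open>\<rho> s\<close> in an energy sublevel, the second makes
    \<open>enn2real\<close> faithful to the slope.\<close>
  define R where "R s \<longleftrightarrow> E (\<rho> s) = ereal (\<phi> s) \<and> G (\<rho> s) < \<infinity>" for s
  define near where "near n t \<longleftrightarrow> (\<exists>s\<ge>t. Wass p (\<rho> t) (\<rho> s) \<le> inverse (real (Suc n)) \<and>
    (enn2real (G (\<rho> s))) powr (p/(p-1)) / (p/(p-1)) \<le> inverse (real (Suc n)) \<and> R s)" for n :: nat and t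
  have near: "\<forall>\<^sub>F t in at_top. near n t" for n
    unfolding near_def
  proof (rule eventually_close_to_small_slope[OF p AC anti bdd])
    show "AE t in lebesgue. t \<in> {0..} \<longrightarrow> (\<phi> has_real_derivative
       (- ((mderiv p {0..} \<rho> t) powr p) / p - ((enn2real (G (\<rho> t))) powr (p/(p-1))) / (p/(p-1)))) (at t within {0..})"
      using slope by eventually_elim auto
    show "AE t in lebesgue. t \<in> {0..} \<longrightarrow> R t"
      using slope \<phi>E unfolding R_def by eventually_elim auto
  qed auto
  have inv0: "(\<lambda>n. inverse (real (Suc n))) \<longlonglongrightarrow> 0" by (rule LIMSEQ_inverse_real_of_nat)
  have lim: "\<exists>r \<mu>. strict_mono r \<and> \<mu> \<in> weak_stationary Et Gt \<and> narrow_conv (\<lambda>n. \<rho> (t (r n))) \<mu>"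
    if t: "\<forall>n. 0 \<le> t n \<and> near n (t n)" for t
  proof -
    have "\<forall>n. \<exists>s. t n \<le> s \<and> Wass p (\<rho> (t n)) (\<rho> s) \<le> inverse (real (Suc n)) \<and>
       (enn2real (G (\<rho> s))) powr (p/(p-1)) / (p/(p-1)) \<le> inverse (real (Suc n)) \<and> R s"
      using t unfolding near_def by blast
    from choice[OF this] obtain s where s: "t n \<le> s n" "Wass p (\<rho> (t n)) (\<rho> (s n)) \<le> inverse (real (Suc n))"
       "(enn2real (G (\<rho> (s n)))) powr (p/(p-1)) / (p/(p-1)) \<le> inverse (real (Suc n))" "R (s n)" for n
      by blast
    have t0: "0 \<le> t n" and s0: "0 \<le> s n" for n using t s(1)[of n] by (auto intro: order_trans)
    have E_le: "E (\<rho> (s n)) \<le> ereal (\<phi> 0)" for n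
      using s(4)[of n] anti'[of 0 "s n"] s0[of n] by (simp add: R_def)
    have Et_le: "Et (\<rho> (s n)) \<le> ereal (\<phi> 0)" for n using E_le ext_E Pp[OF s0] by simp
    \<comment> \<open>Since \<open>\<phi>\<close> is nonincreasing, one sublevel at height
      \<open>\<phi> 0\<close> contains all selected states; either compactness hypothesis makes it a
      relatively compact set.\<close>
    obtain S where S: "rel_compact_narrow S" "\<forall>n. \<rho> (s n) \<in> S"
      using B2_or_B2'
    proof
      assume "\<forall>C::real. rel_compact_narrow {\<mu>\<in>Prob. Et \<mu> \<le> ereal C}"
      then show thesis using Et_le P[OF s0] by (intro that[of "{\<mu>\<in>Prob. Et \<mu> \<le> ereal (\<phi> 0)}"]) auto
    next
      assume "\<exists>Y. Y \<subseteq> Prob \<and> (\<forall>t\<ge>0. \<rho> t \<in> Y) \<and> (\<forall>C::real. rel_compact_narrow {\<mu>\<in>Prob_p p \<inter> Y. E \<mu> \<le> ereal C})"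
      then obtain Y where "\<forall>t\<ge>0. \<rho> t \<in> Y" "\<forall>C::real. rel_compact_narrow {\<mu>\<in>Prob_p p \<inter> Y. E \<mu> \<le> ereal C}" by blast
      then show thesis using E_le Pp[OF s0] s0 by (intro that[of "{\<mu>\<in>Prob_p p \<inter> Y. E \<mu> \<le> ereal (\<phi> 0)}"]) auto
    qed
    have "\<forall>M. (\<forall>n. M n \<in> S) \<longrightarrow> (\<exists>(r :: nat \<Rightarrow> nat) \<mu>. strict_mono r \<and> narrow_conv (M \<circ> r) \<mu>)"
      using S(1) unfolding rel_compact_narrow_def by (elim conjE)
    from mp[OF spec[OF this] S(2)]
    obtain r \<mu> where r: "strict_mono r" and conv: "narrow_conv ((\<lambda>n. \<rho> (s n)) \<circ> r) \<mu>"
      by blast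
    have \<mu>: "\<mu> \<in> Prob" using conv by (simp add: narrow_conv_def)
    have "Et \<mu> \<le> liminf (\<lambda>n. Et (((\<lambda>n. \<rho> (s n)) \<circ> r) n))"
      using B1 conv unfolding lsc_narrow_def by blast
    also have "\<dots> \<le> limsup (\<lambda>n. Et (((\<lambda>n. \<rho> (s n)) \<circ> r) n))" by (intro Liminf_le_Limsup) auto
    also have "\<dots> \<le> ereal (\<phi> 0)" using Et_le by (intro Limsup_bounded always_eventually) auto
    finally have Et\<mu>: "Et \<mu> < \<infinity>" by (auto intro: le_less_trans)
    define q where "q = p / (p - 1)"
    have q: "0 < q" using p by (simp add: q_def)
    define x where "x n = enn2real (G (\<rho> (s n)))" for n
    have Gx: "Gt (\<rho> (s n)) = ennreal (x n)" for n
      using s(4)[of n] ext_G Pp[OF s0[of n]] by (simp add: R_def x_def less_top)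
    have "x \<longlonglongrightarrow> 0"
    proof (rule tendsto_sandwich[OF _ _ tendsto_const])
      show "\<forall>\<^sub>F n in sequentially. x n \<le> (q * inverse (real (Suc n))) powr (1 / q)"
      proof (intro always_eventually allI)
        fix n
        have "x n powr q \<le> q * inverse (real (Suc n))"
          using s(3)[of n] q unfolding x_def q_def[symmetric] by (simp add: pos_divide_le_eq mult.commute)
        then have "(x n powr q) powr (1 / q) \<le> (q * inverse (real (Suc n))) powr (1 / q)"
          using q by (intro powr_mono2) auto
        then show "x n \<le> (q * inverse (real (Suc n))) powr (1 / q)"
          using q by (simp add: powr_powr x_def)
      qed
      have "(\<lambda>n. q * inverse (real (Suc n))) \<longlonglongrightarrow> q * 0" by (intro tendsto_mult tendsto_const inv0)
      then show "(\<lambda>n. (q * inverse (real (Suc n))) powr (1 / q)) \<longlonglongrightarrow> 0"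
        using q by (intro tendsto_zero_powrI[OF _ tendsto_const]) (auto intro!: always_eventually)
    qed (simp add: x_def)
    then have "(\<lambda>n. x (r n)) \<longlonglongrightarrow> 0" using LIMSEQ_subseq_LIMSEQ[OF _ r, of x 0] by (simp add: comp_def)
    then have "(\<lambda>n. ennreal (x (r n))) \<longlonglongrightarrow> ennreal 0" by (rule tendsto_ennrealI)
    then have "liminf (\<lambda>n. Gt (\<rho> (s (r n)))) = 0" unfolding Gx by (intro lim_imp_Liminf) auto
    moreover have "Gt \<mu> \<le> liminf (\<lambda>n. Gt (((\<lambda>n. \<rho> (s n)) \<circ> r) n))"
      using B3 conv unfolding lsc_narrow_def by blast
    ultimately have "Gt \<mu> = 0" by simp
    with Et\<mu> \<mu> have "\<mu> \<in> weak_stationary Et Gt" by (simp add: weak_stationary_def)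
    \<comment> \<open>The states at \<open>t (r n)\<close> and \<open>s (r n)\<close> have the same
      narrow limit, because their Wasserstein distance, and with it their Levy-Prokhorov distance,
      tends to zero.\<close>
    moreover have "narrow_conv (\<lambda>n. \<rho> (t (r n))) \<mu>"
      unfolding narrow_conv_def
    proof (intro conjI allI)
      show "(\<lambda>n. dLP (\<rho> (t (r n))) \<mu>) \<longlonglongrightarrow> 0"
      proof (rule tendsto_sandwich[OF _ _ tendsto_const])
        have "(\<lambda>n. Wass p (\<rho> (t n)) (\<rho> (s n))) \<longlonglongrightarrow> 0"
          using s(2) Wass_nonneg by (intro tendsto_sandwich[OF _ _ tendsto_const inv0] always_eventually allI)
        then have "(\<lambda>n. dLP (\<rho> (t n)) (\<rho> (s n))) \<longlonglongrightarrow> 0"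
          using p Pp t0 s0 by (intro dLP_tendsto_zero_if_Wass) auto
        from LIMSEQ_subseq_LIMSEQ[OF this r]
        have "(\<lambda>n. dLP (\<rho> (t (r n))) (\<rho> (s (r n)))) \<longlonglongrightarrow> 0" by (simp add: comp_def)
        moreover have "(\<lambda>n. dLP (\<rho> (s (r n))) \<mu>) \<longlonglongrightarrow> 0" using conv by (simp add: narrow_conv_def)
        ultimately show "(\<lambda>n. dLP (\<rho> (t (r n))) (\<rho> (s (r n))) + dLP (\<rho> (s (r n))) \<mu>) \<longlonglongrightarrow> 0"
          by (rule tendsto_add_zero)
      qed (intro always_eventually allI dLP_triangle dLP_nonneg P t0 s0 \<mu>)+
    qed (use \<mu> P t0 in auto)
    ultimately show ?thesis using r by blast
  qed
  have SP: "weak_stationary Et Gt \<subseteq> Prob" by (auto simp: weak_stationary_def)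
  have "weak_stationary Et Gt \<inter> Y \<noteq> {} \<and> ((\<lambda>t. dLP_set (\<rho> t) (weak_stationary Et Gt \<inter> Y)) \<longlongrightarrow> 0) at_top"
    if Y: "\<forall>t\<ge>0. \<rho> t \<in> Y" "closed_narrow Y" for Y
  proof (rule dLP_set_tendsto_zero[OF _ P near])
    fix t assume t: "\<forall>n. 0 \<le> t n \<and> near n (t n)"
    from lim[OF t] obtain r \<mu> where *: "strict_mono r" "\<mu> \<in> weak_stationary Et Gt" "narrow_conv (\<lambda>n. \<rho> (t (r n))) \<mu>"
      by blast
    \<comment> \<open>The limit is taken along points of the curve itself, which stays in the closed
      set \<open>Y\<close>.\<close>
    moreover have "\<mu> \<in> Y"
    proof -
      have "\<forall>M \<mu>. (\<forall>n. M n \<in> Y) \<longrightarrow> narrow_conv M \<mu> \<longrightarrow> \<mu> \<in> Y"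
        using Y(2) unfolding closed_narrow_def by (elim conjE)
      moreover have "\<forall>n. \<rho> (t (r n)) \<in> Y" using Y(1) t by blast
      ultimately show ?thesis using *(3) by (auto dest!: spec[of _ "\<lambda>n. \<rho> (t (r n))"])
    qed
    ultimately show "\<exists>r \<mu>. strict_mono r \<and> \<mu> \<in> weak_stationary Et Gt \<inter> Y \<and> narrow_conv (\<lambda>n. \<rho> (t (r n))) \<mu>"
      by blast
  qed (use SP in auto)
  moreover have "weak_stationary Et Gt \<noteq> {} \<and> ((\<lambda>t. dLP_set (\<rho> t) (weak_stationary Et Gt)) \<longlongrightarrow> 0) at_top"
    by (rule dLP_set_tendsto_zero[OF SP P near lim])
  ultimately show ?thesis by blast
qed

end
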